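(* Let $r\in\{0,1\}$, let $\mathbb H_r$ be the Hilbert space of Hilbert–Schmidt operators defined in the context, and let $\tilde\Lambda_0:=\tilde\Lambda_{\sigma_0}\in\mathbb H_r$ be the shifted Dirichlet-to-Neumann operator of the true conductivity $\sigma_0$. Let $\bar\Lambda\in\mathbb H_r$, let $(\psi_j)_{j\ge1}$ be the orthonormal eigenvectors of the prior covariance operator on $\mathbb H_r$ with corresponding eigenvalues $\lambda_j>0$, let $P_R:\mathbb H_r\to\operatorname{span}\{\psi_1,\dots,\psi_R\}$ be the orthogonal projection, and write $$\tilde\Lambda_0-\bar\Lambda=\sum_{j=1}^R\alpha_{0j}\psi_j+E_R,\qquad E_R:=(I-P_R)(\tilde\Lambda_0-\bar\Lambda).$$ Assume $\|E_R\|_{\mathbb H_r}\le b_R$ with $b_R\to0$. For the noisy observation model $Y=\tilde\Lambda_\sigma+\varepsilon W$ set, for $j=1,\dots,R$, $Y_j:=\langle Y-\bar\Lambda,\psi_j\rangle_{\mathbb H_r}$, so that (under the truth) $Y_j=\alpha_{0j}+\varepsilon Z_j$ with $Z_j\sim N(0,1)$ independent. Consider the truncated Gaussian prior $$\tilde\Lambda=\bar\Lambda+\sum_{j=1}^R\alpha_j\psi_j,\qquad \alpha_j\sim N(0,\lambda_j)\ \text{independent},$$ whose posterior is given by independent coefficients $$\alpha_j\mid Y_j\sim N(\mu_j,\tau_j^2),\qquad \mu_j=\frac{\lambda_j}{\lambda_j+\varepsilon^2}Y_j,\quad \tau_j^2=\frac{\lambda_j\varepsilon^2}{\lambda_j+\varepsilon^2},\qquad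 j=1,\dots,R.$$ Denote by $\Pi_{\tilde\Lambda}(\cdot\mid Y)$ the resulting posterior of $\tilde\Lambda$ on $\mathbb H_r$ and by $\Pi_\sigma(\cdot\mid Y):=\mathcal R_{\#}\Pi_{\tilde\Lambda}(\cdot\mid Y)$ its pushforward under the reconstruction map $\mathcal R:\tilde\Lambda\mapsto\sigma$. Assume: (A1) $\displaystyle\sum_{j=1}^R\Bigl(\frac{\varepsilon^2}{\lambda_j+\varepsilon^2}\Bigr)^2\alpha_{0j}^2\le C R\varepsilon^2$ for some constant $C$; (A2) there exist measurable sets $A_\varepsilon\subset\mathbb H_r$ such that $\Pi_{\tilde\Lambda}(A_\varepsilon\mid Y)\to1$ in $P_{\sigma_0}$-probability; (A3) for all $\tilde\Lambda\in A_\varepsilon$, $\|\mathcal R(\tilde\Lambda)-\sigma_0\|_{L^2(D)}\le\omega\bigl(\|\tilde\Lambda-\tilde\Lambda_0\|_{\mathbb H_r}\bigr)$ for some (nondecreasing) modulus of continuity $\omega$. Let $\delta_{\varepsilon,R}:=\varepsilon\sqrt R+b_R$. Then, for every $M_\varepsilon\to\infty$, $$\Pi_\sigma\bigl(\|\sigma-\sigma_0\|_{L^2(D)}>\omega(M_\varepsilon\delta_{\varepsilon,R})\,\big|\,Y\bigr)\to0\quad\text{in }P_{\sigma_0}\text{-probability.}$$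
   Context: Setting (electrical impedance tomography). $D\subset\mathbb R^d$ is a bounded domain with smooth boundary, $D_0$ is a domain compactly contained in $D$, $m\in(0,1)$, and the admissible conductivities are $$\Sigma^\alpha_{m,D_0}=\{\sigma\in C(D):\inf_D\sigma\ge m,\ \sigma=1\text{ on }D\setminus D_0,\ \|\sigma\|_{H^\alpha}\le 1/m\}.$$ For $\sigma$ admissible, $u_{\sigma,f}$ is the weak solution of $\nabla\cdot(\sigma\nabla u)=0$ in $D$, $u=f$ on $\partial D$; the Dirichlet-to-Neumann operator is $\Lambda_\sigma f=\partial u_{\sigma,f}/\partial\nu|_{\partial D}$, and the shifted operator is $\tilde\Lambda_\sigma=\Lambda_\sigma-\Lambda_1$, with $\Lambda_1$ the operator for $\sigma\equiv1$. The space $\mathbb H_r$: let $(\phi_k^{(0)})_{k\ge0}$ be an orthonormal basis of $L^2(\partial D)$ of real Laplace–Beltrami eigenfunctions with $\phi_0^{(0)}$ constant, and let $(\phi_k^{(r)})_{k\ge1}$ be their rescalings forming an orthonormal basis of $H^r(\partial D)/\mathbb C$. With $b_{jk}^{(r)}(f)=\langle f,\phi_j^{(r)}\rangle_{H^r(\partial D)}\phi_k^{(0)}$, $$\mathbb H_r=\Bigl\{T=\sum_{j,k\ge1}t_{jk}b_{jk}^{(r)}:\ t_{jk}\in\mathbb R,\ \sum_{j,k}t_{jk}^2<\infty\Bigr\},\qquad \langle S,T\rangle_{\mathbb H_r}=\sum_{j,k\ge1}s_{jk}t_{jk}.$$ It is known that $\tilde\Lambda_\sigma\in\mathbb H_r$.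 Observation model: $Y=\tilde\Lambda_\sigma+\varepsilon W$ means observing $Y(T)=\langle\tilde\Lambda_\sigma,T\rangle_{\mathbb H_r}+\varepsilon W(T)$ for $T\in\mathbb H_r$, where $W$ is a centered Gaussian process with $\operatorname{Cov}(W(T_1),W(T_2))=\langle T_1,T_2\rangle_{\mathbb H_r}$; accordingly $\langle Y-\bar\Lambda,\psi_j\rangle_{\mathbb H_r}:=Y(\psi_j)-\langle\bar\Lambda,\psi_j\rangle_{\mathbb H_r}$. $P_{\sigma_0}$ is the law of $Y$ when $\sigma=\sigma_0$. The reconstruction map $\mathcal R:\mathbb H_r\to\Sigma^\alpha_{m,D_0}$ is a fixed deterministic measurable map. $\bar\Lambda$ is the prior mean. Limits are as $\varepsilon\to0$; the truncation level $R\ge1$ may depend on $\varepsilon$, $b_R\to0$ as $R\to\infty$, and the constant $C$ in (A1) does not depend on $\varepsilon$ or $R$. *)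

theory Defs
  imports "HOL-Probability.Probability" "HOL-Library.Multiset"
begin

text \<open>
  The Hilbert space \<open>\<H>\<^sub>r\<close> of Hilbert-Schmidt operators \<open>T = \<Sum>\<^sub>j\<^sub>,\<^sub>k\<^sub>\<ge>\<^sub>1 t\<^sub>j\<^sub>k b\<^sub>j\<^sub>k\<close>.
  By definition an element is determined by its square summable real coefficients \<open>t\<^sub>j\<^sub>k\<close> and the
  inner product is that of the coefficients, so the type stores the coefficients.  The boundary,
  the eigenbasis and \<open>r\<close> enter through the operator that \<open>T\<close> represents, see \<open>hs_maps_to\<close>.
\<close>

typedef hs = "{t :: nat \<times> nat \<Rightarrow> real.
    (\<forall>p. p \<notin> {1..} \<times> {1..} \<longrightarrow> t p = 0) \<and> (\<lambda>p. (t p)\<^sup>2) summable_on UNIV}"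
  morphisms coeff Abs_hs
  by (rule exI[of _ "\<lambda>_. 0"]) auto

lemma coeff_outside: "p \<notin> {1..} \<times> {1..} \<Longrightarrow> coeff T p = 0"
  using coeff[of T] by blast

lemma coeff_square_summable: "(\<lambda>p. (coeff T p)\<^sup>2) summable_on UNIV"
  using coeff[of T] by auto

lemma square_summable_mult:
  fixes a b :: "nat \<times> nat \<Rightarrow> real"
  assumes "(\<lambda>p. (a p)\<^sup>2) summable_on UNIV" "(\<lambda>p. (b p)\<^sup>2) summable_on UNIV"
  shows "(\<lambda>p. a p * b p) summable_on UNIV"
proof -
  have "(\<lambda>p. norm (a p * b p)) summable_on UNIV"
    by (rule abs_summable_product) (use assms in \<open>auto simp: power2_eq_square\<close>)
  then show ?thesis
    by (subst summable_on_iff_abs_summable_on_real)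
qed

lemma square_summable_lincomb:
  fixes a b :: "nat \<times> nat \<Rightarrow> real"
  assumes "(\<lambda>p. (a p)\<^sup>2) summable_on UNIV" "(\<lambda>p. (b p)\<^sup>2) summable_on UNIV"
  shows "(\<lambda>p. (c * a p + d * b p)\<^sup>2) summable_on UNIV"
proof -
  have eq: "(\<lambda>p. (c * a p + d * b p)\<^sup>2)
      = (\<lambda>p. c\<^sup>2 * (a p)\<^sup>2 + d\<^sup>2 * (b p)\<^sup>2 + 2 * c * d * (a p * b p))"
    by (auto simp: power2_eq_square algebra_simps)
  show ?thesis
    unfolding eq
    using square_summable_mult[OF assms] assms
    by (intro summable_on_add summable_on_cmult_right)
qed

instantiation hs :: real_inner
begin

definition "0 = Abs_hs (\<lambda>_. 0)"
definition "S + T = Abs_hs (\<lambda>p. coeff S p + coeff T p)"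
definition "S - T = Abs_hs (\<lambda>p. coeff S p - coeff T p)"
definition "- T = Abs_hs (\<lambda>p. - coeff T p)"
definition "c *\<^sub>R T = Abs_hs (\<lambda>p. c * coeff T p)"
definition "inner S T = (\<Sum>\<^sub>\<infinity>p\<in>{1..} \<times> {1..}. coeff S p * coeff T p)"
definition "norm (T :: hs) = sqrt (inner T T)"
definition "dist S (T :: hs) = norm (S - T)"
definition "sgn (T :: hs) = inverse (norm T) *\<^sub>R T"
definition "uniformity = (INF e\<in>{0<..}. principal {(S :: hs, T). dist S T < e})"
definition "open (U :: hs set) \<longleftrightarrow>
  (\<forall>x\<in>U. eventually (\<lambda>(x', y). x' = x \<longrightarrow> y \<in> U) uniformity)"

lemma coeff_zero: "coeff 0 p = 0"
  unfolding zero_hs_def by (subst Abs_hs_inverse) auto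

lemma coeff_add: "coeff (S + T) p = coeff S p + coeff T p"
  unfolding plus_hs_def
  by (subst Abs_hs_inverse)
    (use square_summable_lincomb[of "coeff S" "coeff T" 1 1] in
      \<open>auto simp: coeff_outside coeff_square_summable\<close>)

lemma coeff_diff: "coeff (S - T) p = coeff S p - coeff T p"
  unfolding minus_hs_def
  by (subst Abs_hs_inverse)
    (use square_summable_lincomb[of "coeff S" "coeff T" 1 "-1"] in
      \<open>auto simp: coeff_outside coeff_square_summable\<close>)

lemma coeff_uminus: "coeff (- T) p = - coeff T p"
  unfolding uminus_hs_def
  by (subst Abs_hs_inverse) (auto simp: coeff_outside coeff_square_summable)

lemma coeff_scaleR: "coeff (c *\<^sub>R T) p = c * coeff T p"
  unfolding scaleR_hs_def
  by (subst Abs_hs_inverse)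
    (use square_summable_lincomb[of "coeff T" "coeff T" c 0] in
      \<open>auto simp: coeff_outside coeff_square_summable\<close>)

lemma inner_hs_UNIV: "inner S T = (\<Sum>\<^sub>\<infinity>p. coeff S p * coeff T p)"
  unfolding inner_hs_def
  by (rule infsum_cong_neutral) (auto simp: coeff_outside)

lemma coeff_mult_summable: "(\<lambda>p. coeff S p * coeff T p) summable_on UNIV"
  by (intro square_summable_mult coeff_square_summable)

lemma hs_eqI: "(\<And>p. coeff S p = coeff T p) \<Longrightarrow> S = T"
  by (metis coeff_inject ext)

lemmas coeff_simps = coeff_zero coeff_add coeff_diff coeff_uminus coeff_scaleR

instance
proof
  fix x y z :: hs and r s :: real
  show "x + y + z = x + (y + z)" "x + y = y + x" "0 + x = x" "- x + x = 0" "x - y = x + - y"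
    by (rule hs_eqI; simp add: coeff_simps)+
  show "r *\<^sub>R (x + y) = r *\<^sub>R x + r *\<^sub>R y" "(r + s) *\<^sub>R x = r *\<^sub>R x + s *\<^sub>R x"
    "r *\<^sub>R s *\<^sub>R x = (r * s) *\<^sub>R x" "1 *\<^sub>R x = x"
    by (rule hs_eqI; simp add: coeff_simps algebra_simps)+
  show "sgn x = inverse (norm x) *\<^sub>R x" "dist x y = norm (x - y)" "norm x = sqrt (inner x x)"
    by (fact sgn_hs_def dist_hs_def norm_hs_def)+
  show "uniformity = (INF e\<in>{0<..}. principal {(x :: hs, y). dist x y < e})"
    by (fact uniformity_hs_def)
  show "open U = (\<forall>x\<in>U. eventually (\<lambda>(x', y). x' = x \<longrightarrow> y \<in> U) uniformity)" for U :: "hs set"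
    by (fact open_hs_def)
  show "inner x y = inner y x"
    by (simp add: inner_hs_UNIV mult.commute)
  show "inner (x + y) z = inner x z + inner y z"
    by (simp add: inner_hs_UNIV coeff_simps ring_distribs infsum_add coeff_mult_summable)
  show "inner (r *\<^sub>R x) y = r * inner x y"
    by (simp add: inner_hs_UNIV coeff_simps mult.assoc infsum_cmult_right')
  show "0 \<le> inner x x"
    by (simp add: inner_hs_UNIV infsum_nonneg)
  show "(inner x x = 0) = (x = 0)"
  proof
    assume 0: "inner x x = 0"
    show "x = 0"
    proof (rule hs_eqI)
      fix p
      have "coeff x p * coeff x p = 0"
        by (rule nonneg_infsum_le_0D[of _ UNIV])
          (use 0 coeff_mult_summable in \<open>auto simp: inner_hs_UNIV\<close>)
      then show "coeff x p = coeff 0 p" by (simp add: coeff_zero)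
    qed
  qed (simp add: inner_hs_UNIV coeff_zero)
qed

end

lemma finite_sum_coeff_le_norm:
  assumes "finite F"
  shows "(\<Sum>p\<in>F. (coeff T p)\<^sup>2) \<le> (norm T)\<^sup>2"
proof -
  have "(\<Sum>p\<in>F. (coeff T p)\<^sup>2) \<le> (\<Sum>\<^sub>\<infinity>p. (coeff T p)\<^sup>2)"
    by (rule finite_sum_le_infsum) (use assms in \<open>auto simp: coeff_square_summable\<close>)
  also have "\<dots> = (norm T)\<^sup>2"
    by (simp add: power2_norm_eq_inner inner_hs_UNIV power2_eq_square[symmetric])
  finally show ?thesis .
qed

instance hs :: complete_space
proof
  fix X :: "nat \<Rightarrow> hs"
  assume X: "Cauchy X"
  have le: "\<bar>coeff T p\<bar> \<le> norm T" for T p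
    using finite_sum_coeff_le_norm[of "{p}" T] abs_le_square_iff[of "coeff T p" "norm T"] by simp
  have "Cauchy (\<lambda>n. coeff (X n) p)" for p
    unfolding Cauchy_def
  proof (intro allI impI)
    fix e :: real assume "e > 0"
    then obtain M where "\<And>m n. m \<ge> M \<Longrightarrow> n \<ge> M \<Longrightarrow> dist (X m) (X n) < e"
      using metric_CauchyD[OF X] by blast
    then have "dist (coeff (X m) p) (coeff (X n) p) < e" if "m \<ge> M" "n \<ge> M" for m n
      using le[of "X m - X n" p] that
      by (metis coeff_diff dist_norm order_le_less_trans real_norm_def)
    then show "\<exists>M. \<forall>m\<ge>M. \<forall>n\<ge>M. dist (coeff (X m) p) (coeff (X n) p) < e"
      by blast
  qed
  then have "\<exists>l. (\<lambda>n. coeff (X n) p) \<longlonglongrightarrow> l" for p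
    by (simp add: Cauchy_convergent_iff convergent_def)
  then obtain t where t: "\<And>p. (\<lambda>n. coeff (X n) p) \<longlonglongrightarrow> t p" by metis
  have t0: "t p = 0" if "p \<notin> {1..} \<times> {1..}" for p
    using t[of p] that by (simp add: coeff_outside LIMSEQ_const_iff)
  have bound: "(\<Sum>p\<in>F. (coeff (X m) p - t p)\<^sup>2) \<le> e\<^sup>2"
    if F: "finite F" and M: "\<And>m n. m \<ge> M \<Longrightarrow> n \<ge> M \<Longrightarrow> dist (X m) (X n) < e" and m: "m \<ge> M"
    for F m M e
  proof (rule LIMSEQ_le_const2)
    show "(\<lambda>n. \<Sum>p\<in>F. (coeff (X m) p - coeff (X n) p)\<^sup>2)
        \<longlonglongrightarrow> (\<Sum>p\<in>F. (coeff (X m) p - t p)\<^sup>2)"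
      by (intro tendsto_intros t)
    have "(\<Sum>p\<in>F. (coeff (X m) p - coeff (X n) p)\<^sup>2) \<le> e\<^sup>2" if "n \<ge> M" for n
    proof -
      have "(\<Sum>p\<in>F. (coeff (X m) p - coeff (X n) p)\<^sup>2) \<le> (norm (X m - X n))\<^sup>2"
        using finite_sum_coeff_le_norm[OF F, of "X m - X n"] by (simp add: coeff_diff)
      also have "\<dots> \<le> e\<^sup>2"
        using M[OF m that] by (intro power_mono) (auto simp: dist_norm)
      finally show ?thesis .
    qed
    then show "\<exists>N. \<forall>n\<ge>N. (\<Sum>p\<in>F. (coeff (X m) p - coeff (X n) p)\<^sup>2) \<le> e\<^sup>2" by blast
  qed
  have summ: "(\<lambda>p. (coeff (X m) p - t p)\<^sup>2) summable_on UNIV"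
    if M: "\<And>m n. m \<ge> M \<Longrightarrow> n \<ge> M \<Longrightarrow> dist (X m) (X n) < e" and m: "m \<ge> M" for m M e
  proof (rule nonneg_bdd_above_summable_on)
    show "bdd_above (sum (\<lambda>p. (coeff (X m) p - t p)\<^sup>2) ` {F. F \<subseteq> UNIV \<and> finite F})"
      using bound[OF _ M m] by (intro bdd_aboveI2[where M = "e\<^sup>2"]) blast
  qed simp
  obtain M where M: "\<And>m n. m \<ge> M \<Longrightarrow> n \<ge> M \<Longrightarrow> dist (X m) (X n) < 1"
    using metric_CauchyD[OF X zero_less_one] by blast
  have "(\<lambda>p. (coeff (X M) p - t p)\<^sup>2) summable_on UNIV"
    by (rule summ[OF M order.refl])
  from square_summable_lincomb[OF coeff_square_summable[of "X M"] this, of 1 "-1"]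
  have "(\<lambda>p. (t p)\<^sup>2) summable_on UNIV"
    by simp
  then have coeff_t: "coeff (Abs_hs t) = t"
    by (intro Abs_hs_inverse) (auto simp: t0)
  have "X \<longlonglongrightarrow> Abs_hs t"
    unfolding lim_sequentially
  proof (intro allI impI)
    fix e :: real assume e: "e > 0"
    then obtain N where N: "\<And>m n. m \<ge> N \<Longrightarrow> n \<ge> N \<Longrightarrow> dist (X m) (X n) < e / 2"
      using metric_CauchyD[OF X half_gt_zero] by blast
    have "dist (X m) (Abs_hs t) < e" if m: "m \<ge> N" for m
    proof -
      have "(norm (X m - Abs_hs t))\<^sup>2 = (\<Sum>\<^sub>\<infinity>p. (coeff (X m) p - t p)\<^sup>2)"
        by (simp add: power2_norm_eq_inner inner_hs_UNIV coeff_diff coeff_t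
            power2_eq_square[symmetric])
      also have "\<dots> \<le> (e / 2)\<^sup>2"
        by (rule infsum_le_finite_sums[OF summ[OF N m]]) (use bound[OF _ N m] in auto)
      finally have "norm (X m - Abs_hs t) \<le> e / 2"
        by (rule power2_le_imp_le) (use e in simp)
      then show ?thesis using e by (simp add: dist_norm)
    qed
    then show "\<exists>N. \<forall>n\<ge>N. dist (X n) (Abs_hs t) < e" by blast
  qed
  then show "convergent X" by (auto simp: convergent_def)
qed

instance hs :: second_countable_topology
proof
  define e :: "nat \<times> nat \<Rightarrow> hs" where "e p = Abs_hs (\<lambda>q. if q = p \<and> p \<in> {1..} \<times> {1..} then 1 else 0)" for p
  have ce: "coeff (e p) q = (if q = p \<and> p \<in> {1..} \<times> {1..} then 1 else 0)" for p q
  proof -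
    have "(\<lambda>q. (if q = p \<and> p \<in> {1..} \<times> {1..} then 1 else 0 :: real)\<^sup>2) summable_on UNIV"
      by (subst summable_on_cong_neutral[where T = "{p}" and g = "\<lambda>_. if p \<in> {1..} \<times> {1..} then 1 else 0"])
        auto
    then show ?thesis
      unfolding e_def by (subst Abs_hs_inverse) auto
  qed
  have ne: "norm (e p) \<le> 1" for p
  proof -
    have "(norm (e p))\<^sup>2 = (\<Sum>\<^sub>\<infinity>q. (coeff (e p) q)\<^sup>2)"
      by (simp add: power2_norm_eq_inner inner_hs_UNIV power2_eq_square[symmetric])
    also have "\<dots> = (\<Sum>\<^sub>\<infinity>q\<in>{p}. (if p \<in> {1..} \<times> {1..} then 1 else 0))"
      by (rule infsum_cong_neutral) (auto simp: ce)
    also have "\<dots> \<le> 1\<^sup>2" by simp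
    finally show ?thesis by (rule power2_le_imp_le) simp
  qed
  define E where "E = (\<lambda>(F, q :: (nat \<times> nat \<Rightarrow> real)). \<Sum>p\<in>F. q p *\<^sub>R e p) `
    (SIGMA F:Collect finite. PiE F (\<lambda>_. \<rat>))"
  have cE: "countable E"
    unfolding E_def
    by (intro countable_image countable_SIGMA countable_PiE) (auto simp: countable_rat countable_Collect_finite)
  have dense: "\<exists>y\<in>E. dist x y < r" if r: "r > 0" for x r
  proof -
    have "(sum (\<lambda>p. (coeff x p)\<^sup>2) \<longlongrightarrow> (\<Sum>\<^sub>\<infinity>p. (coeff x p)\<^sup>2)) (finite_subsets_at_top UNIV)"
      by (intro infsum_tendsto coeff_square_summable)
    then have "eventually (\<lambda>F. dist (\<Sum>p\<in>F. (coeff x p)\<^sup>2) (\<Sum>\<^sub>\<infinity>p. (coeff x p)\<^sup>2) < (r/2)\<^sup>2)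
        (finite_subsets_at_top UNIV)"
      by (rule tendstoD) (use r in auto)
    then obtain F where F: "finite F"
      "dist (\<Sum>p\<in>F. (coeff x p)\<^sup>2) (\<Sum>\<^sub>\<infinity>p. (coeff x p)\<^sup>2) < (r/2)\<^sup>2"
      unfolding eventually_finite_subsets_at_top by blast
    define y where "y = (\<Sum>p\<in>F. coeff x p *\<^sub>R e p)"
    have csum: "coeff (\<Sum>p\<in>A. c p *\<^sub>R e p) q = (\<Sum>p\<in>A. c p * coeff (e p) q)" for A c q
      by (induction A rule: infinite_finite_induct) (auto simp: coeff_simps)
    have cy: "coeff y q = (if q \<in> F then coeff x q else 0)" for q
    proof -
      have "coeff y q = (\<Sum>p\<in>F. if p = q then coeff x q else 0)"
        unfolding y_def csum by (intro sum.cong) (auto simp: ce coeff_outside)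
      also have "\<dots> = (if q \<in> F then coeff x q else 0)"
        using F by simp
      finally show ?thesis .
    qed
    have nsq: "(norm T)\<^sup>2 = (\<Sum>\<^sub>\<infinity>q. (coeff T q)\<^sup>2)" for T
      by (simp add: power2_norm_eq_inner inner_hs_UNIV power2_eq_square[symmetric])
    have "inner (x - y) y = (\<Sum>\<^sub>\<infinity>q :: nat \<times> nat. 0)"
      unfolding inner_hs_UNIV by (rule infsum_cong) (auto simp: coeff_diff cy)
    then have "(norm x)\<^sup>2 = (norm (x - y))\<^sup>2 + (norm y)\<^sup>2"
      by (simp add: power2_norm_eq_inner inner_diff_left inner_diff_right inner_commute[of y x])
    moreover have "(norm y)\<^sup>2 = (\<Sum>\<^sub>\<infinity>q\<in>F. (coeff x q)\<^sup>2)"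
      unfolding nsq by (rule infsum_cong_neutral) (auto simp: cy)
    ultimately have "(norm (x - y))\<^sup>2 < (r/2)\<^sup>2"
      using F nsq[of x] by (simp add: dist_real_def abs_if split: if_splits)
    then have xy: "norm (x - y) < r / 2"
      by (rule power_less_imp_less_base) (use r in simp)
    define d where "d = r / (2 * (real (card F) + 1))"
    have d: "d > 0" using r by (simp add: d_def)
    have "\<exists>q\<in>\<rat>. \<bar>coeff x p - q\<bar> < d" for p
      using Rats_dense_in_real[of "coeff x p - d" "coeff x p"] d by (auto intro!: bexI)
    then obtain q where q: "\<And>p. q p \<in> \<rat>" "\<And>p. \<bar>coeff x p - q p\<bar> < d" by metis
    define z where "z = (\<Sum>p\<in>F. restrict q F p *\<^sub>R e p)"
    have "z \<in> E"
      unfolding z_def E_def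
      by (rule image_eqI[of _ _ "(F, restrict q F)"]) (use F q in auto)
    moreover have "norm (y - z) \<le> r / 2"
    proof -
      have "y - z = (\<Sum>p\<in>F. (coeff x p - q p) *\<^sub>R e p)"
        by (simp add: y_def z_def sum_subtractf scaleR_left_diff_distrib)
      also have "norm \<dots> \<le> (\<Sum>p\<in>F. d)"
      proof (rule sum_norm_le)
        fix p
        have "norm ((coeff x p - q p) *\<^sub>R e p) \<le> d * 1"
          unfolding norm_scaleR by (intro mult_mono) (use q(2)[of p] ne[of p] d in auto)
        then show "norm ((coeff x p - q p) *\<^sub>R e p) \<le> d" by simp
      qed
      also have "\<dots> \<le> r / 2"
        using r by (simp add: d_def field_simps)
      finally show ?thesis .
    qed
    ultimately show ?thesis
      using xy norm_triangle_ineq[of "x - y" "y - z"] by (intro bexI[of _ z]) (auto simp: dist_norm)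
  qed
  define B where "B = (\<lambda>(y, n). ball y (1 / Suc n)) ` (E \<times> (UNIV :: nat set))"
  have "topological_basis B"
  proof (rule topological_basisI)
    fix U and x :: hs assume U: "open U" "x \<in> U"
    then obtain r where r: "r > 0" "ball x r \<subseteq> U" by (meson openE)
    then obtain n where n: "1 / Suc n < r / 2"
      by (metis half_gt_zero nat_approx_posE)
    obtain y where y: "y \<in> E" "dist x y < 1 / Suc n"
      using dense[of "1 / Suc n" x] by auto
    have "ball y (1 / Suc n) \<subseteq> ball x r"
    proof
      fix z assume "z \<in> ball y (1 / Suc n)"
      then show "z \<in> ball x r"
        using dist_triangle[of x z y] y n by (simp add: dist_commute)
    qed
    then show "\<exists>B'\<in>B. x \<in> B' \<and> B' \<subseteq> U"
      unfolding B_def using y r by (intro bexI[of _ "ball y (1 / Suc n)"]) (auto simp: dist_commute)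
  qed (auto simp: B_def)
  moreover have "countable B"
    unfolding B_def using cE by auto
  ultimately show "\<exists>B :: hs set set. countable B \<and> open = generate_topology B"
    using topological_basis_imp_subbasis by blast
qed


section \<open>Smooth functions, smooth domains and Sobolev spaces\<close>

definition partial :: "'a::euclidean_space \<Rightarrow> ('a \<Rightarrow> 'b::real_normed_vector) \<Rightarrow> 'a \<Rightarrow> 'b" where
  "partial b f x = frechet_derivative f (at x) b"

fun iter_partial :: "'a::euclidean_space list \<Rightarrow> ('a \<Rightarrow> 'b::real_normed_vector) \<Rightarrow> 'a \<Rightarrow> 'b" where
  "iter_partial [] f = f"
| "iter_partial (b # bs) f = partial b (iter_partial bs f)"

text \<open>Meaningful on open sets only.\<close>

definition smooth_on :: "'a::euclidean_space set \<Rightarrow> ('a \<Rightarrow> 'b::real_normed_vector) \<Rightarrow> bool" where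
  "smooth_on U f \<longleftrightarrow> (\<forall>bs. set bs \<subseteq> Basis \<longrightarrow> iter_partial bs f differentiable_on U)"

definition test_function :: "'a::euclidean_space set \<Rightarrow> ('a \<Rightarrow> real) \<Rightarrow> bool" where
  "test_function D v \<longleftrightarrow>
     smooth_on UNIV v \<and> compact (closure {x. v x \<noteq> 0}) \<and> closure {x. v x \<noteq> 0} \<subseteq> D"

definition grad :: "('a::euclidean_space \<Rightarrow> real) \<Rightarrow> 'a \<Rightarrow> 'a" where
  "grad f x = (\<Sum>b\<in>Basis. partial b f x *\<^sub>R b)"

definition defining_function ::
  "'a::euclidean_space set \<Rightarrow> 'a \<Rightarrow> 'a set \<Rightarrow> ('a \<Rightarrow> real) \<Rightarrow> bool" where
  "defining_function D x U \<rho> \<longleftrightarrow>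
     open U \<and> x \<in> U \<and> smooth_on U \<rho> \<and> (\<forall>y\<in>U. grad \<rho> y \<noteq> 0) \<and>
     D \<inter> U = {y \<in> U. \<rho> y < 0} \<and> frontier D \<inter> U = {y \<in> U. \<rho> y = 0}"

definition bounded_smooth_domain :: "'a::euclidean_space set \<Rightarrow> bool" where
  "bounded_smooth_domain D \<longleftrightarrow>
     open D \<and> connected D \<and> D \<noteq> {} \<and> bounded D \<and>
     (\<forall>x\<in>frontier D. \<exists>U \<rho>. defining_function D x U \<rho>)"

definition compactly_contained_domain :: "'a::euclidean_space set \<Rightarrow> 'a set \<Rightarrow> bool" where
  "compactly_contained_domain D0 D \<longleftrightarrow>
     open D0 \<and> connected D0 \<and> D0 \<noteq> {} \<and> compact (closure D0) \<and> closure D0 \<subseteq> D"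

definition L2 :: "'x measure \<Rightarrow> ('x \<Rightarrow> 'b::{banach, second_countable_topology}) \<Rightarrow> bool" where
  "L2 M f \<longleftrightarrow> f \<in> borel_measurable M \<and> integrable M (\<lambda>x. (norm (f x))\<^sup>2)"

definition L2_norm :: "'x measure \<Rightarrow> ('x \<Rightarrow> 'b::{banach, second_countable_topology}) \<Rightarrow> real" where
  "L2_norm M f = sqrt (LINT x|M. (norm (f x))\<^sup>2)"

definition locally_integrable_on ::
  "'a::euclidean_space set \<Rightarrow> ('a \<Rightarrow> 'b::{banach, second_countable_topology}) \<Rightarrow> bool" where
  "locally_integrable_on D u \<longleftrightarrow> (\<forall>K. compact K \<longrightarrow> K \<subseteq> D \<longrightarrow> set_integrable lebesgue K u)"

text \<open>
  Multi-indices are finite multisets of coordinate directions: the multiplicity of \<open>b \<in> Basis\<close> is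
  the order of differentiation in direction \<open>b\<close>.
\<close>

definition multi_indices :: "nat \<Rightarrow> 'a::euclidean_space multiset set" where
  "multi_indices k = {\<beta>. set_mset \<beta> \<subseteq> Basis \<and> size \<beta> = k}"

definition is_weak_deriv :: "'a::euclidean_space set \<Rightarrow> 'a multiset \<Rightarrow>
    ('a \<Rightarrow> 'b::{banach, second_countable_topology}) \<Rightarrow> ('a \<Rightarrow> 'b) \<Rightarrow> bool" where
  "is_weak_deriv D \<beta> u g \<longleftrightarrow>
     locally_integrable_on D u \<and> locally_integrable_on D g \<and>
     (\<forall>bs v. mset bs = \<beta> \<longrightarrow> test_function D v \<longrightarrow>
        (LINT x|lebesgue_on D. iter_partial bs v x *\<^sub>R u x)
          = (- 1) ^ size \<beta> *\<^sub>R (LINT x|lebesgue_on D. v x *\<^sub>R g x))"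

definition weak_deriv :: "'a::euclidean_space set \<Rightarrow> 'a multiset \<Rightarrow>
    ('a \<Rightarrow> 'b::{banach, second_countable_topology}) \<Rightarrow> 'a \<Rightarrow> 'b" where
  "weak_deriv D \<beta> u = (SOME g. is_weak_deriv D \<beta> u g)"

text \<open>
  The squared norm of \<open>H\<^sup>\<alpha>(D)\<close> for real \<open>\<alpha> \<ge> 0\<close>: for integer \<open>\<alpha>\<close> the sum of the squared \<open>L\<^sup>2\<close> norms
  of the weak derivatives up to order \<open>\<alpha>\<close>, otherwise with the Sobolev-Slobodeckij double integral
  for the derivatives of order \<open>\<lfloor>\<alpha>\<rfloor>\<close>.
\<close>

definition sobolev_sqnorm :: "'a::euclidean_space set \<Rightarrow> real \<Rightarrow> ('a \<Rightarrow> real) \<Rightarrow> ennreal" where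
  "sobolev_sqnorm D \<alpha> u =
     (let k = nat \<lfloor>\<alpha>\<rfloor>; s = \<alpha> - real k in
      if \<forall>l\<le>k. \<forall>\<beta>\<in>multi_indices l. \<exists>g. is_weak_deriv D \<beta> u g
      then (\<Sum>l\<le>k. \<Sum>\<beta>\<in>multi_indices l.
              \<integral>\<^sup>+x. ennreal ((weak_deriv D \<beta> u x)\<^sup>2) \<partial>lebesgue_on D)
         + (if s = 0 then 0 else
            \<Sum>\<beta>\<in>multi_indices k. \<integral>\<^sup>+x. \<integral>\<^sup>+y.
              ennreal ((weak_deriv D \<beta> u x - weak_deriv D \<beta> u y)\<^sup>2
                / norm (x - y) powr (real DIM('a) + 2 * s))
              \<partial>lebesgue_on D \<partial>lebesgue_on D)
      else \<infinity>)"

definition conductivities ::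
  "'a::euclidean_space set \<Rightarrow> 'a set \<Rightarrow> real \<Rightarrow> real \<Rightarrow> ('a \<Rightarrow> real) set" where
  "conductivities D D0 \<alpha> m =
     {\<sigma>. continuous_on D \<sigma> \<and> (\<forall>x\<in>D. m \<le> \<sigma> x) \<and> (\<forall>x\<in>D - D0. \<sigma> x = 1) \<and>
         sobolev_sqnorm D \<alpha> \<sigma> \<le> ennreal ((1 / m)\<^sup>2)}"

text \<open>
  The conductivities with the Borel sets of the \<open>L\<^sup>2(D)\<close> topology, which are generated by balls
  since \<open>L\<^sup>2(D)\<close> is separable.
\<close>

definition conductivity_space ::
  "'a::euclidean_space set \<Rightarrow> 'a set \<Rightarrow> real \<Rightarrow> real \<Rightarrow> ('a \<Rightarrow> real) measure" where
  "conductivity_space D D0 \<alpha> m = sigma (conductivities D D0 \<alpha> m)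
     {{\<tau> \<in> conductivities D D0 \<alpha> m. L2_norm (lebesgue_on D) (\<lambda>x. \<tau> x - \<sigma> x) < \<rho>} | \<sigma> \<rho>.
        \<sigma> \<in> conductivities D D0 \<alpha> m}"


section \<open>The boundary: surface measure, Laplace-Beltrami eigenfunctions, \<open>H\<^sup>r(\<partial>D)\<close>\<close>

definition hausdorff_premeasure :: "nat \<Rightarrow> real \<Rightarrow> 'a::euclidean_space set \<Rightarrow> ennreal" where
  "hausdorff_premeasure s \<delta> A =
     (INF U\<in>{U :: nat \<Rightarrow> 'a set. (\<forall>i. bounded (U i) \<and> diameter (U i) \<le> \<delta>) \<and> A \<subseteq> (\<Union>i. U i)}.
        \<Sum>i. if U i = {} then 0
             else ennreal (unit_ball_vol (real s) * (diameter (U i) / 2) ^ s))"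

definition hausdorff_measure :: "nat \<Rightarrow> 'a::euclidean_space measure" where
  "hausdorff_measure s =
     measure_of UNIV (sets borel) (\<lambda>A. SUP \<delta>\<in>{0<..}. hausdorff_premeasure s \<delta> A)"

definition surface :: "'a::euclidean_space set \<Rightarrow> 'a measure" where
  "surface D = restrict_space (hausdorff_measure (DIM('a) - 1)) (frontier D)"

definition outer_normal :: "'a::euclidean_space set \<Rightarrow> 'a \<Rightarrow> 'a" where
  "outer_normal D x =
     (THE n. \<exists>U \<rho>. defining_function D x U \<rho> \<and> n = grad \<rho> x /\<^sub>R norm (grad \<rho> x))"

text \<open>
  The derivative within \<open>\<partial>D\<close> is determined only on the tangent space, hence the orthogonality to
  the normal.  The Laplace-Beltrami operator is the surface divergence of the tangential gradient.
\<close>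

definition tangential_gradient :: "'a::euclidean_space set \<Rightarrow> ('a \<Rightarrow> real) \<Rightarrow> 'a \<Rightarrow> 'a" where
  "tangential_gradient D f x =
     (THE g. g \<bullet> outer_normal D x = 0 \<and> (f has_derivative (\<lambda>h. g \<bullet> h)) (at x within frontier D))"

definition laplace_beltrami :: "'a::euclidean_space set \<Rightarrow> ('a \<Rightarrow> real) \<Rightarrow> 'a \<Rightarrow> real" where
  "laplace_beltrami D f x =
     (\<Sum>b\<in>Basis. tangential_gradient D (\<lambda>y. tangential_gradient D f y \<bullet> b) x \<bullet> b)"

definition laplace_beltrami_basis ::
  "'a::euclidean_space set \<Rightarrow> (nat \<Rightarrow> 'a \<Rightarrow> real) \<Rightarrow> (nat \<Rightarrow> real) \<Rightarrow> bool" where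
  "laplace_beltrami_basis D \<phi> \<kappa> \<longleftrightarrow>
     (\<forall>k. \<exists>F. smooth_on UNIV F \<and> (\<forall>x\<in>frontier D. \<phi> k x = F x)) \<and>
     (\<forall>k. \<forall>x\<in>frontier D. - laplace_beltrami D (\<phi> k) x = \<kappa> k * \<phi> k x) \<and>
     (\<exists>c. \<forall>x\<in>frontier D. \<phi> 0 x = c) \<and>
     (\<forall>j k. (LINT x|surface D. \<phi> j x * \<phi> k x) = (if j = k then 1 else 0)) \<and>
     (\<forall>f :: 'a \<Rightarrow> complex. L2 (surface D) f \<longrightarrow>
        (\<forall>k. (LINT x|surface D. f x * of_real (\<phi> k x)) = 0) \<longrightarrow> (AE x in surface D. f x = 0))"

definition fourier_coeff ::
  "'a::euclidean_space set \<Rightarrow> (nat \<Rightarrow> 'a \<Rightarrow> real) \<Rightarrow> ('a \<Rightarrow> complex) \<Rightarrow> nat \<Rightarrow> complex" where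
  "fourier_coeff D \<phi> f k = (LINT x|surface D. f x * of_real (\<phi> k x))"

text \<open>
  \<open>H\<^sup>r(\<partial>D)\<close> is normed by \<open>\<parallel>f\<parallel>\<^sup>2 = \<Sum>\<^sub>k (1 + \<kappa>\<^sub>k)\<^sup>r \<bar>\<langle>f, \<phi>\<^sub>k\<rangle>\<bar>\<^sup>2\<close>; for \<open>r = 1\<close> this is
  \<open>\<integral> \<bar>f\<bar>\<^sup>2 + \<bar>\<nabla>f\<bar>\<^sup>2\<close>.
\<close>

definition in_H_boundary :: "'a::euclidean_space set \<Rightarrow> (nat \<Rightarrow> 'a \<Rightarrow> real) \<Rightarrow> (nat \<Rightarrow> real) \<Rightarrow>
    nat \<Rightarrow> ('a \<Rightarrow> complex) \<Rightarrow> bool" where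
  "in_H_boundary D \<phi> \<kappa> r f \<longleftrightarrow>
     L2 (surface D) f \<and>
     (\<lambda>k. (1 + \<kappa> k) ^ r * (cmod (fourier_coeff D \<phi> f k))\<^sup>2) summable_on UNIV"

definition H_boundary_inner :: "'a::euclidean_space set \<Rightarrow> (nat \<Rightarrow> 'a \<Rightarrow> real) \<Rightarrow> (nat \<Rightarrow> real) \<Rightarrow>
    nat \<Rightarrow> ('a \<Rightarrow> complex) \<Rightarrow> ('a \<Rightarrow> complex) \<Rightarrow> complex" where
  "H_boundary_inner D \<phi> \<kappa> r f g =
     (\<Sum>\<^sub>\<infinity>k. of_real ((1 + \<kappa> k) ^ r) * fourier_coeff D \<phi> f k * cnj (fourier_coeff D \<phi> g k))"

definition rescaled :: "(nat \<Rightarrow> 'a \<Rightarrow> real) \<Rightarrow> (nat \<Rightarrow> real) \<Rightarrow> nat \<Rightarrow> nat \<Rightarrow> 'a \<Rightarrow> complex" where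
  "rescaled \<phi> \<kappa> r k x = of_real ((1 + \<kappa> k) powr (- real r / 2) * \<phi> k x)"

definition b_op :: "'a::euclidean_space set \<Rightarrow> (nat \<Rightarrow> 'a \<Rightarrow> real) \<Rightarrow> (nat \<Rightarrow> real) \<Rightarrow>
    nat \<Rightarrow> nat \<Rightarrow> nat \<Rightarrow> ('a \<Rightarrow> complex) \<Rightarrow> 'a \<Rightarrow> complex" where
  "b_op D \<phi> \<kappa> r j k f x = H_boundary_inner D \<phi> \<kappa> r f (rescaled \<phi> \<kappa> r j) * of_real (\<phi> k x)"

text \<open>\<open>T f = h\<close>, that is, \<open>\<Sum>\<^sub>j\<^sub>,\<^sub>k\<^sub>\<ge>\<^sub>1 t\<^sub>j\<^sub>k b\<^sub>j\<^sub>k(f) = h\<close> with convergence in \<open>L\<^sup>2(\<partial>D)\<close>.\<close>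

definition hs_maps_to :: "'a::euclidean_space set \<Rightarrow> (nat \<Rightarrow> 'a \<Rightarrow> real) \<Rightarrow> (nat \<Rightarrow> real) \<Rightarrow>
    nat \<Rightarrow> hs \<Rightarrow> ('a \<Rightarrow> complex) \<Rightarrow> ('a \<Rightarrow> complex) \<Rightarrow> bool" where
  "hs_maps_to D \<phi> \<kappa> r T f h \<longleftrightarrow>
     L2 (surface D) h \<and>
     ((\<lambda>F. L2_norm (surface D)
          (\<lambda>x. h x - (\<Sum>(j, k)\<in>F. of_real (coeff T (j, k)) * b_op D \<phi> \<kappa> r j k f x))) \<longlongrightarrow> 0)
       (finite_subsets_at_top ({1..} \<times> {1..}))"


section \<open>The Dirichlet-to-Neumann operator\<close>

text \<open>
  \<open>u \<in> H\<^sup>1(D)\<close> with weak partial derivatives \<open>G b\<close> and trace \<open>f\<close> on \<open>\<partial>D\<close>; the trace operator is the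
  continuous extension of the restriction of functions smooth up to the boundary.
\<close>

definition H1_with_trace :: "'a::euclidean_space set \<Rightarrow> ('a \<Rightarrow> complex) \<Rightarrow> ('a \<Rightarrow> 'a \<Rightarrow> complex) \<Rightarrow>
    ('a \<Rightarrow> complex) \<Rightarrow> bool" where
  "H1_with_trace D u G f \<longleftrightarrow>
     L2 (lebesgue_on D) u \<and> L2 (surface D) f \<and>
     (\<forall>b\<in>Basis. L2 (lebesgue_on D) (G b) \<and> is_weak_deriv D {#b#} u (G b)) \<and>
     (\<exists>w :: nat \<Rightarrow> 'a \<Rightarrow> complex. (\<forall>n. smooth_on UNIV (w n)) \<and>
        (\<lambda>n. L2_norm (lebesgue_on D) (\<lambda>x. w n x - u x)) \<longlonglongrightarrow> 0 \<and>
        (\<forall>b\<in>Basis. (\<lambda>n. L2_norm (lebesgue_on D) (\<lambda>x. partial b (w n) x - G b x)) \<longlonglongrightarrow> 0) \<and>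
        (\<lambda>n. L2_norm (surface D) (\<lambda>x. w n x - f x)) \<longlonglongrightarrow> 0)"

definition energy_form :: "'a::euclidean_space set \<Rightarrow> ('a \<Rightarrow> real) \<Rightarrow> ('a \<Rightarrow> 'a \<Rightarrow> complex) \<Rightarrow>
    ('a \<Rightarrow> real) \<Rightarrow> complex" where
  "energy_form D \<sigma> G v =
     (LINT x|lebesgue_on D. of_real (\<sigma> x) * (\<Sum>b\<in>Basis. G b x * of_real (partial b v x)))"

definition weak_solution :: "'a::euclidean_space set \<Rightarrow> ('a \<Rightarrow> real) \<Rightarrow> ('a \<Rightarrow> complex) \<Rightarrow>
    ('a \<Rightarrow> complex) \<Rightarrow> ('a \<Rightarrow> 'a \<Rightarrow> complex) \<Rightarrow> bool" where
  "weak_solution D \<sigma> f u G \<longleftrightarrow>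
     H1_with_trace D u G f \<and> (\<forall>v. test_function D v \<longrightarrow> energy_form D \<sigma> G v = 0)"

text \<open>
  \<open>\<Lambda>\<^sub>\<sigma> f = \<partial>u/\<partial>\<nu>\<close> lies in \<open>H\<^sup>-\<^sup>1\<^sup>/\<^sup>2(\<partial>D)\<close> for general \<open>f\<close>, so it is given weakly by its pairing with the
  boundary values of smooth functions \<open>v\<close>: by Green's formula,
  \<open>\<integral>\<^bsub>\<partial>D\<^esub> \<partial>u/\<partial>\<nu> v = \<integral>\<^bsub>D\<^esub> \<sigma> \<nabla>u \<cdot> \<nabla>v\<close>, as \<open>\<sigma> = 1\<close> near \<open>\<partial>D\<close> for admissible \<open>\<sigma>\<close>.
\<close>

definition dirichlet_to_neumann ::
  "'a::euclidean_space set \<Rightarrow> ('a \<Rightarrow> real) \<Rightarrow> ('a \<Rightarrow> complex) \<Rightarrow> ('a \<Rightarrow> real) \<Rightarrow> complex" where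
  "dirichlet_to_neumann D \<sigma> f v = energy_form D \<sigma> (SOME G. \<exists>u. weak_solution D \<sigma> f u G) v"

text \<open>\<open>(\<Lambda>\<^sub>\<sigma> - \<Lambda>\<^sub>1) f = h\<close> with \<open>h \<in> L\<^sup>2(\<partial>D)\<close>.\<close>

definition shifted_DN_maps_to :: "'a::euclidean_space set \<Rightarrow> ('a \<Rightarrow> real) \<Rightarrow>
    ('a \<Rightarrow> complex) \<Rightarrow> ('a \<Rightarrow> complex) \<Rightarrow> bool" where
  "shifted_DN_maps_to D \<sigma> f h \<longleftrightarrow>
     L2 (surface D) h \<and>
     (\<forall>v :: 'a \<Rightarrow> real. smooth_on UNIV v \<longrightarrow>
        dirichlet_to_neumann D \<sigma> f v - dirichlet_to_neumann D (\<lambda>_. 1) f v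
          = (LINT x|surface D. h x * of_real (v x)))"

text \<open>
  The element \<open>T\<close> of \<open>\<H>\<^sub>r\<close> is the operator \<open>\<Lambda>\<^sub>\<sigma> - \<Lambda>\<^sub>1\<close>.  The boundary data \<open>f\<close> range over the
  elements of \<open>H\<^sup>r(\<partial>D)\<close> that are traces of \<open>H\<^sup>1(D)\<close> functions, i.e. over \<open>H\<^sup>1(\<partial>D)\<close> for \<open>r = 1\<close> and over
  the dense subspace \<open>H\<^sup>1\<^sup>/\<^sup>2(\<partial>D)\<close> of \<open>L\<^sup>2(\<partial>D)\<close> for \<open>r = 0\<close>; they include all \<open>\<phi>\<^sub>j\<close>, so \<open>T\<close> is
  determined by \<open>\<sigma>\<close>.
\<close>

definition is_shifted_DN :: "'a::euclidean_space set \<Rightarrow> (nat \<Rightarrow> 'a \<Rightarrow> real) \<Rightarrow> (nat \<Rightarrow> real) \<Rightarrow>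
    nat \<Rightarrow> ('a \<Rightarrow> real) \<Rightarrow> hs \<Rightarrow> bool" where
  "is_shifted_DN D \<phi> \<kappa> r \<sigma> T \<longleftrightarrow>
     (\<forall>f. in_H_boundary D \<phi> \<kappa> r f \<longrightarrow> (\<exists>u G. H1_with_trace D u G f) \<longrightarrow>
        (\<exists>h. shifted_DN_maps_to D \<sigma> f h \<and> hs_maps_to D \<phi> \<kappa> r T f h))"


section \<open>Observations, prior and posterior\<close>

definition gaussian_rv :: "'w measure \<Rightarrow> ('w \<Rightarrow> real) \<Rightarrow> bool" where
  "gaussian_rv M X \<longleftrightarrow> X \<in> borel_measurable M \<and>
     ((\<exists>m s. s > 0 \<and> distributed M lborel X (\<lambda>x. ennreal (normal_density m s x))) \<or>
      (\<exists>m. AE w in M. X w = m))"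

definition gaussian_process :: "'w measure \<Rightarrow> ('i \<Rightarrow> 'w \<Rightarrow> real) \<Rightarrow> bool" where
  "gaussian_process M W \<longleftrightarrow>
     prob_space M \<and> (\<forall>F c. finite F \<longrightarrow> gaussian_rv M (\<lambda>w. \<Sum>i\<in>F. c i * W i w))"

definition white_noise :: "'w measure \<Rightarrow> ('h::real_inner \<Rightarrow> 'w \<Rightarrow> real) \<Rightarrow> bool" where
  "white_noise M W \<longleftrightarrow>
     gaussian_process M W \<and> (\<forall>T. (LINT w|M. W T w) = 0) \<and>
     (\<forall>S T. (LINT w|M. W S w * W T w) = S \<bullet> T)"

text \<open>The law, on path space, of \<open>Y(T) = \<langle>L, T\<rangle> + \<epsilon> W(T)\<close>.\<close>

definition observation_law ::
  "'w measure \<Rightarrow> ('h::real_inner \<Rightarrow> 'w \<Rightarrow> real) \<Rightarrow> 'h \<Rightarrow> real \<Rightarrow> ('h \<Rightarrow> real) measure" where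
  "observation_law M W L \<epsilon> = distr M (\<Pi>\<^sub>M T\<in>UNIV. borel) (\<lambda>w T. L \<bullet> T + \<epsilon> * W T w)"

definition tends_in_probability ::
  "(real \<Rightarrow> 'y measure) \<Rightarrow> (real \<Rightarrow> 'y \<Rightarrow> real) \<Rightarrow> real \<Rightarrow> bool" where
  "tends_in_probability P X c \<longleftrightarrow>
     (\<forall>\<eta>>0. ((\<lambda>\<epsilon>. measure (P \<epsilon>) {y \<in> space (P \<epsilon>). \<bar>X \<epsilon> y - c\<bar> > \<eta>}) \<longlongrightarrow> 0) (at_right 0))"

definition has_mean_covariance ::
  "'h::real_inner measure \<Rightarrow> 'h \<Rightarrow> ('h \<Rightarrow> 'h) \<Rightarrow> bool" where
  "has_mean_covariance \<mu> c K \<longleftrightarrow>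
     prob_space \<mu> \<and> sets \<mu> = sets borel \<and> integrable \<mu> (\<lambda>x. (norm x)\<^sup>2) \<and>
     (\<forall>T. (LINT x|\<mu>. x \<bullet> T) = c \<bullet> T) \<and>
     (\<forall>S T. K S \<bullet> T = (LINT x|\<mu>. ((x - c) \<bullet> S) * ((x - c) \<bullet> T)))"

definition orthogonal_projection :: "'h::real_inner set \<Rightarrow> 'h \<Rightarrow> 'h" where
  "orthogonal_projection V x = (THE y. y \<in> V \<and> (\<forall>v\<in>V. (x - y) \<bullet> v = 0))"

text \<open>The law of independent \<open>a\<^sub>j \<sim> N(c\<^sub>j, s\<^sub>j\<^sup>2)\<close>, \<open>1 \<le> j \<le> R\<close>.\<close>

definition gaussian_coeffs :: "nat \<Rightarrow> (nat \<Rightarrow> real) \<Rightarrow> (nat \<Rightarrow> real) \<Rightarrow> (nat \<Rightarrow> real) measure" where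
  "gaussian_coeffs R c s =
     (\<Pi>\<^sub>M j\<in>{1..R}. density lborel (\<lambda>x. ennreal (normal_density (c j) (s j) x)))"

definition expansion_law :: "'h::real_inner \<Rightarrow> (nat \<Rightarrow> 'h) \<Rightarrow> nat \<Rightarrow> (nat \<Rightarrow> real) measure \<Rightarrow>
    'h measure" where
  "expansion_law L \<psi> R N = distr N borel (\<lambda>a. L + (\<Sum>j=1..R. a j *\<^sub>R \<psi> j))"

definition obs_coeff :: "'h::real_inner \<Rightarrow> (nat \<Rightarrow> 'h) \<Rightarrow> ('h \<Rightarrow> real) \<Rightarrow> nat \<Rightarrow> real" where
  "obs_coeff L \<psi> y j = y (\<psi> j) - L \<bullet> \<psi> j"

definition post_mean :: "real \<Rightarrow> (nat \<Rightarrow> real) \<Rightarrow> (nat \<Rightarrow> real) \<Rightarrow> nat \<Rightarrow> real" where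
  "post_mean \<epsilon> lam Y j = lam j / (lam j + \<epsilon>\<^sup>2) * Y j"

definition post_var :: "real \<Rightarrow> (nat \<Rightarrow> real) \<Rightarrow> nat \<Rightarrow> real" where
  "post_var \<epsilon> lam j = lam j * \<epsilon>\<^sup>2 / (lam j + \<epsilon>\<^sup>2)"

definition prior_coeffs :: "nat \<Rightarrow> (nat \<Rightarrow> real) \<Rightarrow> (nat \<Rightarrow> real) measure" where
  "prior_coeffs R lam = gaussian_coeffs R (\<lambda>_. 0) (\<lambda>j. sqrt (lam j))"

definition posterior_coeffs ::
  "real \<Rightarrow> nat \<Rightarrow> (nat \<Rightarrow> real) \<Rightarrow> (nat \<Rightarrow> real) \<Rightarrow> (nat \<Rightarrow> real) measure" where
  "posterior_coeffs \<epsilon> R lam Y =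
     gaussian_coeffs R (post_mean \<epsilon> lam Y) (\<lambda>j. sqrt (post_var \<epsilon> lam j))"

lemma posterior_coeffs_Bayes:
  assumes eps: "\<epsilon> > 0" and lam: "\<And>j. j \<in> {1..R} \<Longrightarrow> lam j > 0"
  shows "posterior_coeffs \<epsilon> R lam Y = density (prior_coeffs R lam)
    (\<lambda>a. \<Prod>j\<in>{1..R}. ennreal (normal_density (a j) \<epsilon> (Y j)
        / normal_density 0 (sqrt (lam j + \<epsilon>\<^sup>2)) (Y j)))"
proof -
  let ?N = "\<lambda>c s. density lborel (\<lambda>x. ennreal (normal_density c s x))"
  define M where "M = (\<lambda>j. if j \<in> {1..R} then ?N 0 (sqrt (lam j)) else lborel)"
  define M' where "M' = (\<lambda>j. if j \<in> {1..R}
    then ?N (post_mean \<epsilon> lam Y j) (sqrt (post_var \<epsilon> lam j)) else lborel)"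
  define f where "f = (\<lambda>j x. ennreal (normal_density x \<epsilon> (Y j)
    / normal_density 0 (sqrt (lam j + \<epsilon>\<^sup>2)) (Y j)))"
  have pv: "post_var \<epsilon> lam j > 0" if "j \<in> {1..R}" for j
    using lam[OF that] eps by (auto simp: post_var_def intro!: divide_pos_pos add_pos_pos)
  have pN: "sigma_finite_measure (?N c s)" if "s > 0" for c s
    using prob_space_normal_density[OF that, of c] prob_space_imp_sigma_finite by blast
  have "sigma_finite_measure (M j)" "sigma_finite_measure (M' j)" for j
    using pN pv lam by (auto simp: M_def M'_def intro: sigma_finite_lborel)
  then interpret P: product_sigma_finite M + P': product_sigma_finite M'
    by (auto simp: product_sigma_finite_def)
  have dens: "M' j = density (M j) (f j)" if j: "j \<in> {1..R}" for j
  proof -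
    let ?l = "lam j" and ?y = "Y j"
    let ?v = "post_var \<epsilon> lam j" and ?c = "post_mean \<epsilon> lam Y j"
    have l: "?l > 0" and v: "?v > 0" using lam pv j by auto
    have le: "?l + \<epsilon>\<^sup>2 > 0" using l by (simp add: add_pos_nonneg)
    have "normal_density 0 (sqrt ?l) x * (normal_density x \<epsilon> ?y
        / normal_density 0 (sqrt (?l + \<epsilon>\<^sup>2)) ?y) = normal_density ?c (sqrt ?v) x" for x
    proof -
      have ex: "- x\<^sup>2 / (2 * ?l) + - (?y - x)\<^sup>2 / (2 * \<epsilon>\<^sup>2)
          = - (x - ?c)\<^sup>2 / (2 * ?v) + - ?y\<^sup>2 / (2 * (?l + \<epsilon>\<^sup>2))"
      proof -
        have "\<epsilon> \<noteq> 0" "?l \<noteq> 0" "?l + \<epsilon>\<^sup>2 \<noteq> 0" using eps l le by auto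
        then show ?thesis
          unfolding post_mean_def post_var_def
          by (simp add: divide_simps) (simp add: algebra_simps power2_eq_square)
      qed
      have sq: "sqrt (2 * pi * ?l) * sqrt (2 * pi * \<epsilon>\<^sup>2)
          = sqrt (2 * pi * ?v) * sqrt (2 * pi * (?l + \<epsilon>\<^sup>2))"
        using le by (simp add: post_var_def real_sqrt_mult[symmetric])
      have "normal_density 0 (sqrt ?l) x * normal_density x \<epsilon> ?y
          = exp (- x\<^sup>2 / (2 * ?l) + - (?y - x)\<^sup>2 / (2 * \<epsilon>\<^sup>2))
            / (sqrt (2 * pi * ?l) * sqrt (2 * pi * \<epsilon>\<^sup>2))"
        using l eps by (simp add: normal_density_def mult_exp_exp)
      also have "\<dots> = normal_density ?c (sqrt ?v) x * normal_density 0 (sqrt (?l + \<epsilon>\<^sup>2)) ?y"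
        unfolding ex sq exp_add using v le by (simp add: normal_density_def)
      finally show ?thesis
        using normal_density_pos[of "sqrt (?l + \<epsilon>\<^sup>2)" 0 ?y] le by (simp add: field_simps)
    qed
    then have "(\<lambda>x. ennreal (normal_density 0 (sqrt ?l) x) * f j x)
        = (\<lambda>x. ennreal (normal_density ?c (sqrt ?v) x))"
      by (simp add: f_def ennreal_mult'[symmetric])
    moreover have "f j \<in> borel_measurable lborel"
      by (simp add: f_def normal_density_def)
    ultimately show ?thesis
      using j by (simp add: M_def M'_def density_density_eq)
  qed
  have "density (PiM {1..R} M) (\<lambda>a. \<Prod>j\<in>{1..R}. f j (a j)) = PiM {1..R} M'"
  proof (rule P'.PiM_eqI)
    have fm: "f j \<in> borel_measurable (M j)" for j
      by (simp add: f_def M_def normal_density_def)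
    have sM: "sets (M' j) = sets (M j)" for j
      by (simp add: M_def M'_def)
    show "sets (density (PiM {1..R} M) (\<lambda>a. \<Prod>j\<in>{1..R}. f j (a j))) = sets (PiM {1..R} M')"
      by (simp add: sM cong: sets_PiM_cong)
    fix A assume A: "\<And>i. i \<in> {1..R} \<Longrightarrow> A i \<in> sets (M' i)"
    then have A': "\<And>i. i \<in> {1..R} \<Longrightarrow> A i \<in> sets (M i)" by (simp add: sM)
    have "emeasure (density (PiM {1..R} M) (\<lambda>a. \<Prod>j\<in>{1..R}. f j (a j))) (PiE {1..R} A)
        = (\<integral>\<^sup>+a. (\<Prod>j\<in>{1..R}. f j (a j)) * indicator (PiE {1..R} A) a \<partial>PiM {1..R} M)"
      using A' fm by (intro emeasure_density borel_measurable_prod_ennreal sets_PiM_I_finite) auto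
    also have "\<dots> = (\<integral>\<^sup>+a. (\<Prod>j\<in>{1..R}. f j (a j) * indicator (A j) (a j)) \<partial>PiM {1..R} M)"
    proof (rule nn_integral_cong)
      fix a assume "a \<in> space (PiM {1..R} M)"
      then have "indicator (PiE {1..R} A) a = (\<Prod>j\<in>{1..R}. indicator (A j) (a j) :: ennreal)"
        by (auto simp: indicator_def space_PiM PiE_iff prod.neutral intro!: prod_zero)
      then show "(\<Prod>j\<in>{1..R}. f j (a j)) * indicator (PiE {1..R} A) a
          = (\<Prod>j\<in>{1..R}. f j (a j) * indicator (A j) (a j))"
        by (simp add: prod.distrib)
    qed
    also have "\<dots> = (\<Prod>j\<in>{1..R}. \<integral>\<^sup>+x. f j x * indicator (A j) x \<partial>M j)"
      using A' fm by (intro P.product_nn_integral_prod) auto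
    also have "\<dots> = (\<Prod>j\<in>{1..R}. emeasure (M' j) (A j))"
      using A' fm by (intro prod.cong refl) (simp add: dens emeasure_density)
    finally show "emeasure (density (PiM {1..R} M) (\<lambda>a. \<Prod>j\<in>{1..R}. f j (a j))) (PiE {1..R} A)
        = (\<Prod>j\<in>{1..R}. emeasure (M' j) (A j))" .
  qed simp
  moreover have "PiM {1..R} M = prior_coeffs R lam" "PiM {1..R} M' = posterior_coeffs \<epsilon> R lam Y"
    unfolding prior_coeffs_def posterior_coeffs_def gaussian_coeffs_def M_def M'_def
    by (auto intro!: PiM_cong)
  ultimately show ?thesis by (simp add: f_def)
qed

definition truncated_prior ::
  "'h::real_inner \<Rightarrow> (nat \<Rightarrow> 'h) \<Rightarrow> (nat \<Rightarrow> real) \<Rightarrow> nat \<Rightarrow> 'h measure" where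
  "truncated_prior L \<psi> lam R = expansion_law L \<psi> R (prior_coeffs R lam)"

definition posterior :: "'h::real_inner \<Rightarrow> (nat \<Rightarrow> 'h) \<Rightarrow> (nat \<Rightarrow> real) \<Rightarrow> nat \<Rightarrow> real \<Rightarrow>
    ('h \<Rightarrow> real) \<Rightarrow> 'h measure" where
  "posterior L \<psi> lam R \<epsilon> y =
     expansion_law L \<psi> R (posterior_coeffs \<epsilon> R lam (obs_coeff L \<psi> y))"

text \<open>
  \<open>posterior\<close> is the Bayes posterior for the truncated prior and the data
  \<open>Y\<^sub>j \<sim> N(\<langle>T - L, \<psi>\<^sub>j\<rangle>, \<epsilon>\<^sup>2)\<close>: its density with respect to the prior is likelihood over evidence.
\<close>

lemma posterior_Bayes:
  fixes L :: "'h::{real_inner, second_countable_topology}"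
  assumes eps: "\<epsilon> > 0" and lam: "\<And>j. j \<in> {1..R} \<Longrightarrow> lam j > 0"
    and orth: "\<And>i j. i \<in> {1..R} \<Longrightarrow> j \<in> {1..R} \<Longrightarrow> \<psi> i \<bullet> \<psi> j = (if i = j then 1 else 0)"
  shows "posterior L \<psi> lam R \<epsilon> y = density (truncated_prior L \<psi> lam R)
    (\<lambda>T. \<Prod>j\<in>{1..R}. ennreal (normal_density ((T - L) \<bullet> \<psi> j) \<epsilon> (obs_coeff L \<psi> y j)
        / normal_density 0 (sqrt (lam j + \<epsilon>\<^sup>2)) (obs_coeff L \<psi> y j)))"
proof -
  define f where "f = (\<lambda>a. L + (\<Sum>j=1..R. a j *\<^sub>R \<psi> j))"
  define g where "g = (\<lambda>T. \<Prod>j\<in>{1..R}. ennreal (normal_density ((T - L) \<bullet> \<psi> j) \<epsilon>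
      (obs_coeff L \<psi> y j) / normal_density 0 (sqrt (lam j + \<epsilon>\<^sup>2)) (obs_coeff L \<psi> y j)))"
  have "(\<lambda>a. a j) \<in> borel_measurable (prior_coeffs R lam)" if "j \<in> {1..R}" for j
    using measurable_component_singleton[OF that,
        of "\<lambda>j. density lborel (\<lambda>x. ennreal (normal_density 0 (sqrt (lam j)) x))"]
    by (simp add: prior_coeffs_def gaussian_coeffs_def)
  then have f: "f \<in> borel_measurable (prior_coeffs R lam)"
    unfolding f_def by (intro borel_measurable_add borel_measurable_sum borel_measurable_scaleR) auto
  have g: "g \<in> borel_measurable borel"
    unfolding g_def normal_density_def by measurable
  have "g (f a) = (\<Prod>j\<in>{1..R}. ennreal (normal_density (a j) \<epsilon> (obs_coeff L \<psi> y j)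
      / normal_density 0 (sqrt (lam j + \<epsilon>\<^sup>2)) (obs_coeff L \<psi> y j)))" for a
    unfolding g_def
  proof (rule prod.cong[OF refl])
    fix j assume j: "j \<in> {1..R}"
    have "(f a - L) \<bullet> \<psi> j = (\<Sum>i=1..R. a i * (\<psi> i \<bullet> \<psi> j))"
      by (simp add: f_def inner_sum_left)
    also have "\<dots> = (\<Sum>i=1..R. if i = j then a j else 0)"
      by (rule sum.cong) (use orth j in auto)
    finally have "(f a - L) \<bullet> \<psi> j = (\<Sum>i=1..R. if i = j then a j else 0)" .
    then show "ennreal (normal_density ((f a - L) \<bullet> \<psi> j) \<epsilon> (obs_coeff L \<psi> y j)
        / normal_density 0 (sqrt (lam j + \<epsilon>\<^sup>2)) (obs_coeff L \<psi> y j))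
      = ennreal (normal_density (a j) \<epsilon> (obs_coeff L \<psi> y j)
        / normal_density 0 (sqrt (lam j + \<epsilon>\<^sup>2)) (obs_coeff L \<psi> y j))"
      using j by simp
  qed
  then have "posterior L \<psi> lam R \<epsilon> y = distr (density (prior_coeffs R lam) (\<lambda>a. g (f a))) borel f"
    using posterior_coeffs_Bayes[where R = R, OF eps lam]
    by (simp add: posterior_def expansion_law_def f_def)
  also have "\<dots> = density (truncated_prior L \<psi> lam R) g"
    using density_distr[OF g f]
    by (simp add: truncated_prior_def expansion_law_def f_def)
  finally show ?thesis by (simp add: g_def)
qed

definition modulus_of_continuity :: "(real \<Rightarrow> real) \<Rightarrow> bool" where
  "modulus_of_continuity \<omega> \<longleftrightarrow> \<omega> 0 = 0 \<and> mono_on {0..} \<omega> \<and> (\<omega> \<longlongrightarrow> 0) (at_right 0)"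

end

theory Submission
  imports Defs
begin

text \<open>
  The proof is a Chebyshev argument in the Hilbert space, transported by the modulus of continuity.

  The posterior has independent Gaussian coordinates, so its mean squared distance to the truth is
  controlled by variance plus squared bias of the \<open>R\<close> coordinates plus the squared tail
  \<open>b\<^sub>R\<^sup>2\<close> (\<open>gaussian_expansion_tail_bound\<close>). Each posterior variance is at most \<open>\<epsilon>\<^sup>2\<close>, and the
  posterior mean misses \<open>\<alpha>\<^sub>0\<^sub>j\<close> by a shrinkage bias and by a contraction of the noise \<open>\<epsilon> Z\<^sub>j\<close>
  (\<open>post_mean_error\<close>). Since \<open>Z\<^sub>j\<close> has second moment 1 and the sum of the squared biases is
  \<open>O(R \<epsilon>\<^sup>2)\<close> by (A1), the expectation over the data of the posterior mean squared distance is at most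
  a constant times \<open>R \<epsilon>\<^sup>2 + b\<^sub>R\<^sup>2 \<le> \<delta>\<^sup>2\<close>. Markov's inequality under the posterior and again under the
  law of the data shows that the posterior mass of \<open>{T. \<parallel>T - L\<^sub>0\<parallel> > M \<delta>}\<close> exceeds \<open>\<eta>\<close> with probability
  \<open>O(1 / (\<eta> M\<^sup>2))\<close> (\<open>posterior_contraction_bound\<close>). On \<open>A\<^sub>\<epsilon>\<close> an error of more than
  \<open>\<omega>(M \<delta>)\<close> in the reconstruction forces \<open>\<parallel>T - L\<^sub>0\<parallel> > M \<delta>\<close> because \<open>\<omega>\<close> is nondecreasing, and the
  complement of \<open>A\<^sub>\<epsilon>\<close> has vanishing posterior mass (\<open>pushforward_mass_le\<close>).

  A union bound over data sets requires these sets to be measurable, and this is where some care is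
  needed: a measure is 0 on nonmeasurable sets, so (A2) says something about the posterior mass of
  \<open>A\<^sub>\<epsilon>\<close> only because that mass is a measurable function of the data
  (\<open>posterior_measurable_in_data\<close>).
\<close>

section \<open>Chebyshev bounds for Gaussian series\<close>

lemma (in prob_space) Markov_strict:
  fixes u :: "'a \<Rightarrow> real"
  assumes "integrable M u" "\<And>x. 0 \<le> u x" "expectation u \<le> B" "0 < c"
  shows "prob {x \<in> space M. u x > c} \<le> B / c"
proof -
  have "prob {x \<in> space M. u x > c} \<le> prob {x \<in> space M. u x \<ge> c}"
    using assms(1) by (intro finite_measure_mono) auto
  also have "\<dots> \<le> expectation u / c"
    using assms by (intro integral_Markov_inequality_measure[where A = "{}"]) auto
  also have "\<dots> \<le> B / c"
    using assms by (intro divide_right_mono) auto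
  finally show ?thesis .
qed

text \<open>
  Variance plus squared bias: expand \<open>(x - c)\<^sup>2\<close> around the mean \<open>m\<close> and use the central moments of
  order 2, 1 and 0.
\<close>

lemma normal_mean_square_deviation:
  assumes s: "s > 0"
  shows "has_bochner_integral (density lborel (\<lambda>x. ennreal (normal_density m s x)))
    (\<lambda>x. (x - c)\<^sup>2) (s\<^sup>2 + (m - c)\<^sup>2)"
proof -
  have "has_bochner_integral lborel (\<lambda>x. normal_density m s x * (x - m) ^ (2 * 1)
      + normal_density m s x * (x - m) ^ (2 * 0 + 1) * (2 * (m - c))
      + normal_density m s x * (x - m) ^ (2 * 0) * (m - c)\<^sup>2)
      (fact (2 * 1) / ((2 / s\<^sup>2) ^ 1 * fact 1) + 0 * (2 * (m - c))
        + fact (2 * 0) / ((2 / s\<^sup>2) ^ 0 * fact 0) * (m - c)\<^sup>2)"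
    by (intro has_bochner_integral_add has_bochner_integral_mult_left
        normal_moment_even normal_moment_odd s)
  then have "has_bochner_integral lborel (\<lambda>x. normal_density m s x *\<^sub>R (x - c)\<^sup>2) (s\<^sup>2 + (m - c)\<^sup>2)"
    by (rule has_bochner_integral_cong[THEN iffD1, rotated 3])
      (auto simp: power2_eq_square algebra_simps)
  then show ?thesis
    by (intro has_bochner_integral_density) auto
qed

lemma prob_space_gaussian_coeffs:
  assumes "\<And>j. j \<in> {1..R} \<Longrightarrow> s j > 0"
  shows "prob_space (gaussian_coeffs R c s)"
  unfolding gaussian_coeffs_def
  using assms by (intro prob_space_PiM prob_space_normal_density) auto

lemma gaussian_coeffs_component:
  assumes j: "j \<in> {1..R}"
  shows "(\<lambda>a. a j) \<in> borel_measurable (gaussian_coeffs R c s)"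
  using measurable_component_singleton[OF j,
      of "\<lambda>j. density lborel (\<lambda>x. ennreal (normal_density (c j) (s j) x))"]
  by (simp add: gaussian_coeffs_def)

lemma gaussian_coeffs_mean_square_deviation:
  assumes s: "\<And>j. j \<in> {1..R} \<Longrightarrow> s j > 0"
  shows "has_bochner_integral (gaussian_coeffs R c s) (\<lambda>a. \<Sum>j=1..R. (a j - t j)\<^sup>2)
    (\<Sum>j=1..R. (s j)\<^sup>2 + (c j - t j)\<^sup>2)"
proof (rule has_bochner_integral_sum)
  fix j assume j: "j \<in> {1..R}"
  let ?N = "\<lambda>j. density lborel (\<lambda>x. ennreal (normal_density (c j) (s j) x))"
  have "distr (gaussian_coeffs R c s) (?N j) (\<lambda>a. a j) = ?N j"
    unfolding gaussian_coeffs_def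
    using s by (intro distr_PiM_component prob_space_normal_density j) auto
  then have "has_bochner_integral (distr (gaussian_coeffs R c s) (?N j) (\<lambda>a. a j))
      (\<lambda>x. (x - t j)\<^sup>2) ((s j)\<^sup>2 + (c j - t j)\<^sup>2)"
    using normal_mean_square_deviation[OF s[OF j]] by simp
  moreover have "(\<lambda>a. a j) \<in> measurable (gaussian_coeffs R c s) (?N j)"
    using gaussian_coeffs_component[OF j, of c s] by simp
  ultimately show "has_bochner_integral (gaussian_coeffs R c s) (\<lambda>a. (a j - t j)\<^sup>2)
      ((s j)\<^sup>2 + (c j - t j)\<^sup>2)"
    by (subst (asm) has_bochner_integral_iff)
       (auto simp: has_bochner_integral_iff integrable_distr_eq integral_distr)
qed

lemma norm_orthonormal_sum_squared:
  fixes \<psi> :: "nat \<Rightarrow> 'h::real_inner"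
  assumes orth: "\<And>i j. i \<in> I \<Longrightarrow> j \<in> I \<Longrightarrow> \<psi> i \<bullet> \<psi> j = (if i = j then 1 else 0)"
    and I: "finite I"
  shows "(norm (\<Sum>j\<in>I. a j *\<^sub>R \<psi> j))\<^sup>2 = (\<Sum>j\<in>I. (a j)\<^sup>2)"
proof -
  have "(norm (\<Sum>j\<in>I. a j *\<^sub>R \<psi> j))\<^sup>2 = (\<Sum>i\<in>I. \<Sum>j\<in>I. a i * (a j * (\<psi> j \<bullet> \<psi> i)))"
    by (simp add: power2_norm_eq_inner inner_sum_left inner_sum_right sum_distrib_left)
  also have "\<dots> = (\<Sum>i\<in>I. \<Sum>j\<in>I. if i = j then (a i)\<^sup>2 else 0)"
    by (intro sum.cong) (auto simp: orth power2_eq_square)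
  finally show ?thesis
    using I by simp
qed

lemma expansion_measurable:
  fixes \<psi> :: "nat \<Rightarrow> 'h::{real_inner, second_countable_topology}"
  shows "(\<lambda>a. L + (\<Sum>j=1..R. a j *\<^sub>R \<psi> j)) \<in> borel_measurable (gaussian_coeffs R c s)"
  by (intro borel_measurable_add borel_measurable_sum borel_measurable_scaleR)
    (auto intro: gaussian_coeffs_component)

lemma prob_space_expansion_law:
  fixes \<psi> :: "nat \<Rightarrow> 'h::{real_inner, second_countable_topology}"
  assumes "\<And>j. j \<in> {1..R} \<Longrightarrow> s j > 0"
  shows "prob_space (expansion_law L \<psi> R (gaussian_coeffs R c s))"
  unfolding expansion_law_def
  by (rule prob_space.prob_space_distr[OF prob_space_gaussian_coeffs expansion_measurable])
    (use assms in auto)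

text \<open>
  The squared distance to the target is at most twice the squared error in the first \<open>R\<close>
  coordinates plus twice the squared tail, and the former has an explicit mean (variance plus
  squared bias), so Markov's inequality applies.
\<close>

lemma gaussian_expansion_tail_bound:
  fixes \<psi> :: "nat \<Rightarrow> 'h::{real_inner, second_countable_topology}"
  assumes s: "\<And>j. j \<in> {1..R} \<Longrightarrow> s j > 0"
    and orth: "\<And>i j. i \<in> {1..R} \<Longrightarrow> j \<in> {1..R} \<Longrightarrow> \<psi> i \<bullet> \<psi> j = (if i = j then 1 else 0)"
    and target: "L0 = L + (\<Sum>j=1..R. t j *\<^sub>R \<psi> j) + e" "norm e \<le> b"
    and \<rho>: "\<rho> > 0"
  shows "measure (expansion_law L \<psi> R (gaussian_coeffs R c s)) {T. norm (T - L0) > \<rho>}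
    \<le> (2 * (\<Sum>j=1..R. (s j)\<^sup>2 + (c j - t j)\<^sup>2) + 2 * b\<^sup>2) / \<rho>\<^sup>2"
proof -
  let ?N = "gaussian_coeffs R c s"
  let ?f = "\<lambda>a. L + (\<Sum>j=1..R. a j *\<^sub>R \<psi> j)"
  let ?u = "\<lambda>a. 2 * (\<Sum>j=1..R. (a j - t j)\<^sup>2) + 2 * b\<^sup>2"
  let ?B = "2 * (\<Sum>j=1..R. (s j)\<^sup>2 + (c j - t j)\<^sup>2) + 2 * b\<^sup>2"
  interpret prob_space ?N
    using s by (rule prob_space_gaussian_coeffs)
  have "has_bochner_integral ?N ?u ?B"
    using gaussian_coeffs_mean_square_deviation[of R s c t, OF s]
    by (intro has_bochner_integral_add has_bochner_integral_mult_right)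
      (auto simp: has_bochner_integral_iff prob_space)
  then have u: "integrable ?N ?u" "expectation ?u = ?B"
    by (auto simp: has_bochner_integral_iff)
  have le: "(norm (?f a - L0))\<^sup>2 \<le> ?u a" for a
  proof -
    have "?f a - L0 = (\<Sum>j=1..R. (a j - t j) *\<^sub>R \<psi> j) - e"
      by (simp add: target(1) sum_subtractf scaleR_left_diff_distrib)
    then have "norm (?f a - L0) \<le> norm (\<Sum>j=1..R. (a j - t j) *\<^sub>R \<psi> j) + b"
      using norm_triangle_ineq4[of "\<Sum>j=1..R. (a j - t j) *\<^sub>R \<psi> j" e] target(2) by simp
    then have "(norm (?f a - L0))\<^sup>2 \<le> (norm (\<Sum>j=1..R. (a j - t j) *\<^sub>R \<psi> j) + b)\<^sup>2"
      by (rule power_mono) simp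
    also have "\<dots> \<le> 2 * (norm (\<Sum>j=1..R. (a j - t j) *\<^sub>R \<psi> j))\<^sup>2 + 2 * b\<^sup>2"
      using zero_le_power2[of "norm (\<Sum>j=1..R. (a j - t j) *\<^sub>R \<psi> j) - b"]
      by (simp add: power2_eq_square algebra_simps)
    finally show ?thesis
      using norm_orthonormal_sum_squared[of "{1..R}" \<psi> "\<lambda>j. a j - t j", OF orth] by simp
  qed
  have "measure (expansion_law L \<psi> R ?N) {T. norm (T - L0) > \<rho>}
      = prob {a \<in> space ?N. norm (?f a - L0) > \<rho>}"
    unfolding expansion_law_def
    by (subst measure_distr[OF expansion_measurable]) (auto intro!: arg_cong[where f = prob])
  also have "\<dots> \<le> prob {a \<in> space ?N. ?u a > \<rho>\<^sup>2}"
  proof (rule finite_measure_mono)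
    show "{a \<in> space ?N. norm (?f a - L0) > \<rho>} \<subseteq> {a \<in> space ?N. ?u a > \<rho>\<^sup>2}"
      using le \<rho> by (auto intro: less_le_trans[OF power_strict_mono])
    show "{a \<in> space ?N. ?u a > \<rho>\<^sup>2} \<in> events"
      using u(1) by measurable
  qed
  also have "\<dots> \<le> ?B / \<rho>\<^sup>2"
    using u \<rho> by (intro Markov_strict) (auto intro!: add_nonneg_nonneg sum_nonneg)
  finally show ?thesis .
qed


section \<open>The posterior as a function of the data\<close>

lemma post_var_bounds:
  assumes "\<epsilon> > 0" "lam j > 0"
  shows "0 < post_var \<epsilon> lam j" "post_var \<epsilon> lam j \<le> \<epsilon>\<^sup>2"
proof -
  show "0 < post_var \<epsilon> lam j"
    using assms by (auto simp: post_var_def intro!: divide_pos_pos add_pos_pos)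
  have "lam j / (lam j + \<epsilon>\<^sup>2) * \<epsilon>\<^sup>2 \<le> 1 * \<epsilon>\<^sup>2"
    using assms by (intro mult_right_mono) (auto simp: divide_simps add_pos_pos)
  then show "post_var \<epsilon> lam j \<le> \<epsilon>\<^sup>2"
    by (simp add: post_var_def)
qed

text \<open>
  The posterior mean shrinks the datum \<open>t + \<epsilon> z\<close> by the factor \<open>\<lambda>\<^sub>j / (\<lambda>\<^sub>j + \<epsilon>\<^sup>2) \<le> 1\<close>, which
  produces the bias \<open>- t \<epsilon>\<^sup>2 / (\<lambda>\<^sub>j + \<epsilon>\<^sup>2)\<close> and does not increase the noise.
\<close>

lemma post_mean_error:
  assumes "lam j > 0" and Y: "Y j = t + \<epsilon> * z"
  shows "(post_mean \<epsilon> lam Y j - t)\<^sup>2 \<le> 2 * ((\<epsilon>\<^sup>2 / (lam j + \<epsilon>\<^sup>2))\<^sup>2 * t\<^sup>2) + 2 * \<epsilon>\<^sup>2 * z\<^sup>2"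
proof -
  define q where "q = lam j / (lam j + \<epsilon>\<^sup>2)"
  have pos: "lam j + \<epsilon>\<^sup>2 > 0"
    using assms by (simp add: add_pos_nonneg)
  then have q: "0 \<le> q" "q \<le> 1" "\<epsilon>\<^sup>2 / (lam j + \<epsilon>\<^sup>2) = 1 - q"
    using assms by (auto simp: q_def field_simps)
  have "(post_mean \<epsilon> lam Y j - t)\<^sup>2 = (q * (\<epsilon> * z) - (1 - q) * t)\<^sup>2"
    by (simp add: post_mean_def Y q_def[symmetric] algebra_simps)
  also have "\<dots> \<le> 2 * ((1 - q)\<^sup>2 * t\<^sup>2) + 2 * (q\<^sup>2 * (\<epsilon> * z)\<^sup>2)"
    using zero_le_power2[of "q * (\<epsilon> * z) + (1 - q) * t"]
    by (simp add: power2_eq_square algebra_simps)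
  also have "q\<^sup>2 * (\<epsilon> * z)\<^sup>2 \<le> 1 * (\<epsilon> * z)\<^sup>2"
    using q by (intro mult_right_mono) (auto simp: power_le_one)
  finally show ?thesis
    by (simp add: q(3) power_mult_distrib)
qed

lemma normal_density_measurable:
  assumes "f \<in> borel_measurable M" "g \<in> borel_measurable M"
  shows "(\<lambda>x. normal_density (f x) s (g x)) \<in> borel_measurable M"
  unfolding normal_density_def using assms by measurable

lemma obs_coeff_measurable:
  "(\<lambda>y. obs_coeff L \<psi> y j) \<in> borel_measurable (\<Pi>\<^sub>M T\<in>UNIV. borel)"
  unfolding obs_coeff_def by measurable

text \<open>
  By Bayes' formula a posterior mass is an integral against the prior, which does not
  depend on the data, of a likelihood that is jointly measurable in parameter and data.
\<close>

lemma posterior_measurable_in_data: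
  fixes L :: "'h::{real_inner, second_countable_topology}"
  assumes eps: "\<epsilon> > 0" and lam: "\<And>j. j \<in> {1..R} \<Longrightarrow> lam j > 0"
    and orth: "\<And>i j. i \<in> {1..R} \<Longrightarrow> j \<in> {1..R} \<Longrightarrow> \<psi> i \<bullet> \<psi> j = (if i = j then 1 else 0)"
    and A: "A \<in> sets borel"
  shows "(\<lambda>y. measure (posterior L \<psi> lam R \<epsilon> y) A) \<in> borel_measurable (\<Pi>\<^sub>M T\<in>UNIV. borel)"
proof -
  let ?Pr = "truncated_prior L \<psi> lam R"
  let ?Y = "\<Pi>\<^sub>M T\<in>(UNIV :: 'h set). (borel :: real measure)"
  let ?g = "\<lambda>y T. \<Prod>j\<in>{1..R}. ennreal (normal_density ((T - L) \<bullet> \<psi> j) \<epsilon> (obs_coeff L \<psi> y j)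
        / normal_density 0 (sqrt (lam j + \<epsilon>\<^sup>2)) (obs_coeff L \<psi> y j))"
  have sets: "sets ?Pr = sets borel"
    by (simp add: truncated_prior_def expansion_law_def)
  interpret Pr: prob_space ?Pr
    unfolding truncated_prior_def prior_coeffs_def
    using lam by (intro prob_space_expansion_law) simp
  have Y: "(\<lambda>p. obs_coeff L \<psi> (fst p) j) \<in> borel_measurable (?Y \<Otimes>\<^sub>M ?Pr)" for j
    by (rule measurable_compose[OF measurable_fst obs_coeff_measurable])
  have T: "(\<lambda>p. (snd p - L) \<bullet> \<psi> j) \<in> borel_measurable (?Y \<Otimes>\<^sub>M ?Pr)" for j
  proof (rule measurable_compose[OF measurable_snd])
    show "(\<lambda>T. (T - L) \<bullet> \<psi> j) \<in> borel_measurable ?Pr"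
      by (simp add: measurable_cong_sets[OF sets refl])
  qed
  have A_Pr: "A \<in> sets ?Pr"
    using A sets by simp
  have g: "(\<lambda>p. ?g (fst p) (snd p) * indicator A (snd p)) \<in> borel_measurable (?Y \<Otimes>\<^sub>M ?Pr)"
    by (intro borel_measurable_times_ennreal borel_measurable_prod_ennreal
        measurable_compose[OF _ measurable_ennreal] borel_measurable_divide
        normal_density_measurable Y T borel_measurable_const
        measurable_compose[OF measurable_snd borel_measurable_indicator] A_Pr)
  have "emeasure (posterior L \<psi> lam R \<epsilon> y) A = (\<integral>\<^sup>+T. ?g y T * indicator A T \<partial>?Pr)" for y
  proof -
    have "?g y \<in> borel_measurable borel"
      by (intro borel_measurable_prod_ennreal measurable_compose[OF _ measurable_ennreal]
          borel_measurable_divide normal_density_measurable) auto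
    then show ?thesis
      using posterior_Bayes[where R = R and \<psi> = \<psi> and L = L and y = y and lam = lam, OF eps lam orth] A_Pr
      by (simp add: emeasure_density measurable_cong_sets[OF sets refl])
  qed
  then have "(\<lambda>y. emeasure (posterior L \<psi> lam R \<epsilon> y) A) \<in> borel_measurable ?Y"
    using Pr.borel_measurable_nn_integral[of "\<lambda>y T. ?g y T * indicator A T" ?Y] g
    by (simp add: case_prod_beta)
  then show ?thesis
    unfolding measure_def by measurable
qed

lemma prob_space_posterior:
  fixes L :: "'h::{real_inner, second_countable_topology}"
  assumes "\<epsilon> > 0" "\<And>j. j \<in> {1..R} \<Longrightarrow> lam j > 0"
  shows "prob_space (posterior L \<psi> lam R \<epsilon> y)"
  unfolding posterior_def posterior_coeffs_def
  using post_var_bounds assms by (intro prob_space_expansion_law) simp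


section \<open>The data under the truth\<close>

lemma inner_orthonormal_sum:
  fixes \<psi> :: "nat \<Rightarrow> 'h::real_inner"
  assumes orth: "\<And>i j. i \<in> I \<Longrightarrow> j \<in> I \<Longrightarrow> \<psi> i \<bullet> \<psi> j = (if i = j then 1 else 0)"
    and I: "finite I" "i \<in> I"
  shows "(\<Sum>j\<in>I. a j *\<^sub>R \<psi> j) \<bullet> \<psi> i = a i"
proof -
  have "(\<Sum>j\<in>I. a j *\<^sub>R \<psi> j) \<bullet> \<psi> i = (\<Sum>j\<in>I. if j = i then a j else 0)"
    unfolding inner_sum_left by (intro sum.cong) (auto simp: orth I)
  then show ?thesis using I by simp
qed

lemma orthogonal_projection_span_orthonormal:
  fixes \<psi> :: "nat \<Rightarrow> 'h::real_inner"
  assumes orth: "\<And>i j. i \<in> I \<Longrightarrow> j \<in> I \<Longrightarrow> \<psi> i \<bullet> \<psi> j = (if i = j then 1 else 0)"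
    and I: "finite I"
  shows "orthogonal_projection (span (\<psi> ` I)) x = (\<Sum>j\<in>I. (x \<bullet> \<psi> j) *\<^sub>R \<psi> j)"
  unfolding orthogonal_projection_def
proof (rule the_equality)
  let ?y = "\<Sum>j\<in>I. (x \<bullet> \<psi> j) *\<^sub>R \<psi> j"
  have "?y \<bullet> \<psi> i = x \<bullet> \<psi> i" if "i \<in> I" for i
    using orth I that by (rule inner_orthonormal_sum)
  then have "orthogonal (x - ?y) v" if "v \<in> \<psi> ` I" for v
    using that by (auto simp: orthogonal_def inner_diff_left)
  then have "orthogonal (x - ?y) v" if "v \<in> span (\<psi> ` I)" for v
    using orthogonal_to_span[OF that] by blast
  moreover have "?y \<in> span (\<psi> ` I)"
    by (intro span_sum span_scale span_base) auto
  ultimately show y: "?y \<in> span (\<psi> ` I) \<and> (\<forall>v\<in>span (\<psi> ` I). (x - ?y) \<bullet> v = 0)"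
    by (auto simp: orthogonal_def)
  fix z assume z: "z \<in> span (\<psi> ` I) \<and> (\<forall>v\<in>span (\<psi> ` I). (x - z) \<bullet> v = 0)"
  then have "z - ?y \<in> span (\<psi> ` I)"
    using y by (intro span_diff) auto
  then have "(x - ?y) \<bullet> (z - ?y) - (x - z) \<bullet> (z - ?y) = 0"
    using y z by simp
  then have "(z - ?y) \<bullet> (z - ?y) = 0"
    by (simp add: inner_diff_left)
  then show "z = ?y" by simp
qed

lemma white_noise_measurable:
  assumes "white_noise M W"
  shows "W T \<in> borel_measurable M"
proof -
  have "finite F \<Longrightarrow> gaussian_rv M (\<lambda>w. \<Sum>i\<in>F. c i * W i w)" for F c
    using assms by (simp add: white_noise_def gaussian_process_def)
  from this[of "{T}" "\<lambda>_. 1"] show ?thesis by (simp add: gaussian_rv_def)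
qed

text \<open>
  The integral of a nonintegrable function is 0, so the noise having variance 1 includes its
  square integrability.
\<close>

lemma white_noise_unit_variance:
  assumes "white_noise M W" "T \<bullet> T = 1"
  shows "has_bochner_integral M (\<lambda>w. (W T w)\<^sup>2) 1"
proof -
  have "(LINT w|M. (W T w)\<^sup>2) = 1"
    using assms by (simp add: white_noise_def power2_eq_square)
  then show ?thesis
    using not_integrable_integral_eq[of M "\<lambda>w. (W T w)\<^sup>2"]
    by (auto simp: has_bochner_integral_iff)
qed

lemma observation_measurable:
  assumes "white_noise M W"
  shows "(\<lambda>w T. L \<bullet> T + \<epsilon> * W T w) \<in> measurable M (\<Pi>\<^sub>M T\<in>UNIV. borel)"
  using white_noise_measurable[OF assms] by (intro measurable_PiM_single') auto

lemma prob_space_observation_law: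
  assumes "white_noise M W"
  shows "prob_space (observation_law M W L \<epsilon>)"
proof -
  have "prob_space M"
    using assms by (simp add: white_noise_def gaussian_process_def)
  then show ?thesis
    unfolding observation_law_def
    by (rule prob_space.prob_space_distr) (rule observation_measurable[OF assms])
qed

text \<open>
  The posterior expectation of \<open>\<Sum>\<^sub>j (\<alpha>\<^sub>j - t\<^sub>j)\<^sup>2\<close>, given by its closed form so that it is visibly a
  measurable function of the data.
\<close>

definition posterior_mean_square_error ::
  "(nat \<Rightarrow> real) \<Rightarrow> nat \<Rightarrow> real \<Rightarrow> (nat \<Rightarrow> real) \<Rightarrow> (nat \<Rightarrow> real) \<Rightarrow> real" where
  "posterior_mean_square_error lam R \<epsilon> t Y =
     (\<Sum>j=1..R. post_var \<epsilon> lam j + (post_mean \<epsilon> lam Y j - t j)\<^sup>2)"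

lemma posterior_mean_square_error_measurable:
  "(\<lambda>y. posterior_mean_square_error lam R \<epsilon> t (obs_coeff L \<psi> y))
    \<in> borel_measurable (\<Pi>\<^sub>M T\<in>UNIV. borel)"
  unfolding posterior_mean_square_error_def post_mean_def
  by (intro borel_measurable_sum borel_measurable_add borel_measurable_power
      borel_measurable_diff borel_measurable_times borel_measurable_const obs_coeff_measurable)

text \<open>
  Each of the \<open>R\<close> coordinates contributes at most \<open>\<epsilon>\<^sup>2\<close> from the posterior variance and \<open>2 \<epsilon>\<^sup>2\<close> from
  the noise in the posterior mean; the remaining term is the squared shrinkage bias.
\<close>

lemma expected_posterior_mean_square_error:
  fixes \<psi> :: "nat \<Rightarrow> 'h::real_inner"
  assumes noise: "white_noise M W"
    and eps: "\<epsilon> > 0" and lam: "\<And>j. j \<in> {1..R} \<Longrightarrow> lam j > 0"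
    and unit: "\<And>j. j \<in> {1..R} \<Longrightarrow> \<psi> j \<bullet> \<psi> j = 1"
    and t: "\<And>j. j \<in> {1..R} \<Longrightarrow> (L0 - L) \<bullet> \<psi> j = t j"
  defines "Q \<equiv> \<lambda>y. posterior_mean_square_error lam R \<epsilon> t (obs_coeff L \<psi> y)"
  shows "integrable (observation_law M W L0 \<epsilon>) Q"
    and "(LINT y|observation_law M W L0 \<epsilon>. Q y)
      \<le> 3 * real R * \<epsilon>\<^sup>2 + 2 * (\<Sum>j=1..R. (\<epsilon>\<^sup>2 / (lam j + \<epsilon>\<^sup>2))\<^sup>2 * (t j)\<^sup>2)"
proof -
  let ?obs = "\<lambda>w T. L0 \<bullet> T + \<epsilon> * W T w"
  let ?bias = "\<lambda>j. (\<epsilon>\<^sup>2 / (lam j + \<epsilon>\<^sup>2))\<^sup>2 * (t j)\<^sup>2"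
  let ?U = "\<lambda>w. \<Sum>j=1..R. \<epsilon>\<^sup>2 + (2 * ?bias j + 2 * \<epsilon>\<^sup>2 * (W (\<psi> j) w)\<^sup>2)"
  interpret prob_space M
    using noise by (simp add: white_noise_def gaussian_process_def)
  note meas = observation_measurable[OF noise, of L0 \<epsilon>]
  have Qm: "Q \<in> borel_measurable (\<Pi>\<^sub>M T\<in>UNIV. borel)"
    unfolding Q_def by (rule posterior_mean_square_error_measurable)
  have const: "has_bochner_integral M (\<lambda>w. k) k" for k :: real
    by (simp add: has_bochner_integral_iff prob_space)
  have "has_bochner_integral M ?U (\<Sum>j=1..R. \<epsilon>\<^sup>2 + (2 * ?bias j + 2 * \<epsilon>\<^sup>2 * 1))"
    by (intro has_bochner_integral_sum has_bochner_integral_add has_bochner_integral_mult_right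
        const white_noise_unit_variance[OF noise] unit) auto
  then have U: "integrable M ?U" "expectation ?U = 3 * real R * \<epsilon>\<^sup>2 + 2 * (\<Sum>j=1..R. ?bias j)"
    by (auto simp: has_bochner_integral_iff sum.distrib sum_distrib_left)
  have Q: "0 \<le> Q (?obs w)" "Q (?obs w) \<le> ?U w" for w
  proof -
    show "0 \<le> Q (?obs w)"
      unfolding Q_def posterior_mean_square_error_def
      using post_var_bounds(1)[where lam = lam, OF eps lam]
      by (intro sum_nonneg add_nonneg_nonneg) (auto intro: less_imp_le)
    show "Q (?obs w) \<le> ?U w"
      unfolding Q_def posterior_mean_square_error_def
    proof (intro sum_mono add_mono)
      fix j assume j: "j \<in> {1..R}"
      show "post_var \<epsilon> lam j \<le> \<epsilon>\<^sup>2"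
        using post_var_bounds(2)[where lam = lam, OF eps lam[OF j]] .
      have "obs_coeff L \<psi> (?obs w) j = t j + \<epsilon> * W (\<psi> j) w"
        using t[OF j] by (simp add: obs_coeff_def inner_diff_left)
      then show "(post_mean \<epsilon> lam (obs_coeff L \<psi> (?obs w)) j - t j)\<^sup>2
          \<le> 2 * ?bias j + 2 * \<epsilon>\<^sup>2 * (W (\<psi> j) w)\<^sup>2"
        by (rule post_mean_error[where lam = lam and j = j, OF lam[OF j]])
    qed
  qed
  have int: "integrable M (\<lambda>w. Q (?obs w))"
    using Q by (intro Bochner_Integration.integrable_bound[OF U(1)] measurable_compose[OF meas Qm])
      (auto intro!: order.trans[OF _ abs_ge_self])
  then show "integrable (observation_law M W L0 \<epsilon>) Q"
    unfolding observation_law_def using meas Qm by (simp add: integrable_distr_eq)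
  have "(LINT y|observation_law M W L0 \<epsilon>. Q y) = expectation (\<lambda>w. Q (?obs w))"
    unfolding observation_law_def using meas Qm by (simp add: integral_distr)
  also have "\<dots> \<le> expectation ?U"
    using int U(1) Q(2) by (rule integral_mono)
  also note U(2)
  finally show "(LINT y|observation_law M W L0 \<epsilon>. Q y) \<le> 3 * real R * \<epsilon>\<^sup>2 + 2 * (\<Sum>j=1..R. ?bias j)" .
qed


section \<open>Contraction of the posterior\<close>

text \<open>
  Markov's inequality is used twice: under the posterior for the distance to the truth, and under
  the law of the data for the resulting mean square error.
\<close>

lemma posterior_contraction_bound:
  fixes \<psi> :: "nat \<Rightarrow> 'h::{real_inner, second_countable_topology}"
  assumes noise: "white_noise M W"
    and eps: "\<epsilon> > 0" and lam: "\<And>j. j \<in> {1..R} \<Longrightarrow> lam j > 0"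
    and orth: "\<And>i j. i \<in> {1..R} \<Longrightarrow> j \<in> {1..R} \<Longrightarrow> \<psi> i \<bullet> \<psi> j = (if i = j then 1 else 0)"
    and t: "\<And>j. j \<in> {1..R} \<Longrightarrow> (L0 - L) \<bullet> \<psi> j = t j"
    and truth: "L0 = L + (\<Sum>j=1..R. t j *\<^sub>R \<psi> j) + e" "norm e \<le> b"
    and pos: "\<rho> > 0" "\<eta> > 0"
  defines "P \<equiv> observation_law M W L0 \<epsilon>"
  shows "measure P {y \<in> space P. measure (posterior L \<psi> lam R \<epsilon> y) {T. norm (T - L0) > \<rho>} > \<eta>}
    \<le> (6 * real R * \<epsilon>\<^sup>2 + 4 * (\<Sum>j=1..R. (\<epsilon>\<^sup>2 / (lam j + \<epsilon>\<^sup>2))\<^sup>2 * (t j)\<^sup>2) + 2 * b\<^sup>2)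
      / (\<eta> * \<rho>\<^sup>2)"
proof -
  let ?post = "\<lambda>y. measure (posterior L \<psi> lam R \<epsilon> y) {T. norm (T - L0) > \<rho>}"
  let ?Q = "\<lambda>y. posterior_mean_square_error lam R \<epsilon> t (obs_coeff L \<psi> y)"
  let ?u = "\<lambda>y. 2 * ?Q y + 2 * b\<^sup>2"
  interpret P: prob_space P
    unfolding P_def by (rule prob_space_observation_law[OF noise])
  have unit: "\<psi> j \<bullet> \<psi> j = 1" if "j \<in> {1..R}" for j
    using orth that by simp
  note Q = expected_posterior_mean_square_error[where L = L and lam = lam and R = R and \<psi> = \<psi> and t = t,
      OF noise eps lam unit t, folded P_def]
  have post: "?post y \<le> ?u y / \<rho>\<^sup>2" for y
  proof -
    have v: "0 < post_var \<epsilon> lam j" if "j \<in> {1..R}" for j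
      using post_var_bounds(1)[where lam = lam, OF eps lam[OF that]] .
    have "?post y \<le> (2 * (\<Sum>j=1..R. (sqrt (post_var \<epsilon> lam j))\<^sup>2
        + (post_mean \<epsilon> lam (obs_coeff L \<psi> y) j - t j)\<^sup>2) + 2 * b\<^sup>2) / \<rho>\<^sup>2"
      unfolding posterior_def posterior_coeffs_def
      by (rule gaussian_expansion_tail_bound[OF _ orth truth pos(1)]) (use v in auto)
    also have "(\<Sum>j=1..R. (sqrt (post_var \<epsilon> lam j))\<^sup>2
        + (post_mean \<epsilon> lam (obs_coeff L \<psi> y) j - t j)\<^sup>2) = ?Q y"
      unfolding posterior_mean_square_error_def using v by (intro sum.cong) (auto intro: less_imp_le)
    finally show ?thesis .
  qed
  have "P.prob {y \<in> space P. ?post y > \<eta>} \<le> P.prob {y \<in> space P. ?u y > \<eta> * \<rho>\<^sup>2}"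
  proof (rule P.finite_measure_mono)
    show "{y \<in> space P. ?post y > \<eta>} \<subseteq> {y \<in> space P. ?u y > \<eta> * \<rho>\<^sup>2}"
    proof safe
      fix y assume "?post y > \<eta>"
      then have "\<eta> < ?u y / \<rho>\<^sup>2"
        using post[of y] by linarith
      then show "\<eta> * \<rho>\<^sup>2 < ?u y"
        using pos by (simp add: pos_less_divide_eq)
    qed
    show "{y \<in> space P. ?u y > \<eta> * \<rho>\<^sup>2} \<in> P.events"
      using borel_measurable_integrable[OF Q(1)] by measurable
  qed
  also have "\<dots> \<le> (6 * real R * \<epsilon>\<^sup>2 + 4 * (\<Sum>j=1..R. (\<epsilon>\<^sup>2 / (lam j + \<epsilon>\<^sup>2))\<^sup>2 * (t j)\<^sup>2) + 2 * b\<^sup>2)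
      / (\<eta> * \<rho>\<^sup>2)"
  proof (rule P.Markov_strict)
    show "integrable P ?u" using Q(1) by auto
    have "0 \<le> ?Q y" for y
      unfolding posterior_mean_square_error_def
      using post_var_bounds(1)[where lam = lam, OF eps lam]
      by (intro sum_nonneg add_nonneg_nonneg) (auto intro: less_imp_le)
    then show "0 \<le> ?u y" for y by simp
    have "P.expectation ?u = 2 * P.expectation ?Q + 2 * b\<^sup>2"
      using Q(1) by (simp add: P.prob_space)
    then show "P.expectation ?u \<le> 6 * real R * \<epsilon>\<^sup>2
        + 4 * (\<Sum>j=1..R. (\<epsilon>\<^sup>2 / (lam j + \<epsilon>\<^sup>2))\<^sup>2 * (t j)\<^sup>2) + 2 * b\<^sup>2"
      using Q(2) by linarith
  qed (use pos in simp)
  finally show ?thesis .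
qed

text \<open>
  The preimage of \<open>S\<close> lies in the union of \<open>B\<close> and the complement of \<open>A\<close>. In the application \<open>B\<close>
  consists of the operators far from the truth and \<open>S\<close> of the conductivities far from the truth.
\<close>

lemma (in prob_space) pushforward_mass_le:
  assumes f: "f \<in> measurable M N" and A: "A \<in> events" and B: "B \<in> events"
    and S: "\<And>x. x \<in> A \<Longrightarrow> f x \<in> S \<Longrightarrow> x \<in> B"
  shows "measure (distr M N f) S \<le> 1 - prob A + prob B"
  \<comment> \<open>A nonmeasurable \<open>S\<close> has measure 0 by convention, and the right-hand side is nonnegative.\<close>
proof (cases "S \<in> sets N")
  case True
  then have "measure (distr M N f) S = prob (f -` S \<inter> space M)"
    by (rule measure_distr[OF f])
  also have "\<dots> \<le> prob ((space M - A) \<union> B)"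
    using S A B by (intro finite_measure_mono) auto
  also have "\<dots> \<le> prob (space M - A) + prob B"
    using A B by (intro measure_Un_le) auto
  finally show ?thesis
    using A by (simp add: prob_compl)
next
  case False
  then show ?thesis
    using prob_le_1[of A] by (simp add: measure_notin_sets add_nonneg_nonneg)
qed


theorem theorem3p7:
  fixes D D0 :: "'a::euclidean_space set" and \<alpha> m :: real and \<sigma>0 :: "'a \<Rightarrow> real"
    and \<phi> :: "nat \<Rightarrow> 'a \<Rightarrow> real" and \<kappa> :: "nat \<Rightarrow> real" and r :: nat
    and L0 Lbar :: hs and Prior :: "hs measure" and K :: "hs \<Rightarrow> hs"
    and \<psi> :: "nat \<Rightarrow> hs" and lam \<alpha>0 :: "nat \<Rightarrow> real"
    and M :: "'w measure" and W :: "hs \<Rightarrow> 'w \<Rightarrow> real"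
    and Rec :: "hs \<Rightarrow> 'a \<Rightarrow> real"
    and R :: "real \<Rightarrow> nat" and E :: "nat \<Rightarrow> hs" and b :: "nat \<Rightarrow> real"
    and A :: "real \<Rightarrow> hs set" and \<omega> :: "real \<Rightarrow> real"
  assumes domain: "bounded_smooth_domain D" "compactly_contained_domain D0 D"
    and param: "0 < m" "m < 1" "0 \<le> \<alpha>"
    and truth: "\<sigma>0 \<in> conductivities D D0 \<alpha> m"
    and basis: "laplace_beltrami_basis D \<phi> \<kappa>"
    and r: "r \<in> {0, 1}"
    and L0: "is_shifted_DN D \<phi> \<kappa> r \<sigma>0 L0"
    and prior: "has_mean_covariance Prior Lbar K"
    and orthonormal: "\<And>i j. 1 \<le> i \<Longrightarrow> 1 \<le> j \<Longrightarrow> \<psi> i \<bullet> \<psi> j = (if i = j then 1 else 0)"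
    and eigen: "\<And>j. 1 \<le> j \<Longrightarrow> K (\<psi> j) = lam j *\<^sub>R \<psi> j" "\<And>j. 1 \<le> j \<Longrightarrow> lam j > 0"
    and E: "\<And>n. 1 \<le> n \<Longrightarrow>
      E n = (L0 - Lbar) - orthogonal_projection (span (\<psi> ` {1..n})) (L0 - Lbar)"
    and decomposition: "\<And>n. 1 \<le> n \<Longrightarrow> L0 - Lbar = (\<Sum>j=1..n. \<alpha>0 j *\<^sub>R \<psi> j) + E n"
    and R: "\<And>\<epsilon>. \<epsilon> > 0 \<Longrightarrow> 1 \<le> R \<epsilon>"
    and bias: "\<And>\<epsilon>. \<epsilon> > 0 \<Longrightarrow> norm (E (R \<epsilon>)) \<le> b (R \<epsilon>)" "b \<longlonglongrightarrow> 0"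
    and noise: "white_noise M W"
    and Rec: "Rec \<in> measurable borel (conductivity_space D D0 \<alpha> m)"
    and A1: "\<exists>C. \<forall>\<epsilon>>0. (\<Sum>j=1..R \<epsilon>. (\<epsilon>\<^sup>2 / (lam j + \<epsilon>\<^sup>2))\<^sup>2 * (\<alpha>0 j)\<^sup>2) \<le> C * real (R \<epsilon>) * \<epsilon>\<^sup>2"
    and A2: "\<And>\<epsilon>. \<epsilon> > 0 \<Longrightarrow> A \<epsilon> \<in> sets borel"
      "tends_in_probability (observation_law M W L0)
        (\<lambda>\<epsilon> y. measure (posterior Lbar \<psi> lam (R \<epsilon>) \<epsilon> y) (A \<epsilon>)) 1"
    and A3: "modulus_of_continuity \<omega>"
      "\<And>\<epsilon> T. \<epsilon> > 0 \<Longrightarrow> T \<in> A \<epsilon> \<Longrightarrow>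
        L2_norm (lebesgue_on D) (\<lambda>x. Rec T x - \<sigma>0 x) \<le> \<omega> (norm (T - L0))"
  shows "\<forall>Meps :: real \<Rightarrow> real. filterlim Meps at_top (at_right 0) \<longrightarrow>
    tends_in_probability (observation_law M W L0)
      (\<lambda>\<epsilon> y. measure
        (distr (posterior Lbar \<psi> lam (R \<epsilon>) \<epsilon> y) (conductivity_space D D0 \<alpha> m) Rec)
        {\<sigma> \<in> conductivities D D0 \<alpha> m.
          L2_norm (lebesgue_on D) (\<lambda>x. \<sigma> x - \<sigma>0 x)
            > \<omega> (Meps \<epsilon> * (\<epsilon> * sqrt (real (R \<epsilon>)) + b (R \<epsilon>)))})
      0"
proof (intro allI impI)
  fix Meps :: "real \<Rightarrow> real"
  assume Meps: "filterlim Meps at_top (at_right 0)"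
  define \<delta> where "\<delta> \<epsilon> = \<epsilon> * sqrt (real (R \<epsilon>)) + b (R \<epsilon>)" for \<epsilon>
  define P where "P = observation_law M W L0"
  define Post where "Post \<epsilon> y = posterior Lbar \<psi> lam (R \<epsilon>) \<epsilon> y" for \<epsilon> y
  define S where "S \<epsilon> = {\<sigma> \<in> conductivities D D0 \<alpha> m.
    L2_norm (lebesgue_on D) (\<lambda>x. \<sigma> x - \<sigma>0 x) > \<omega> (Meps \<epsilon> * \<delta> \<epsilon>)}" for \<epsilon>
  define X where "X \<epsilon> y = measure (distr (Post \<epsilon> y) (conductivity_space D D0 \<alpha> m) Rec) (S \<epsilon>)"
    for \<epsilon> y
  define far where "far \<epsilon> = {T. norm (T - L0) > Meps \<epsilon> * \<delta> \<epsilon>}" for \<epsilon>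
  obtain C where C: "\<And>\<epsilon>. \<epsilon> > 0 \<Longrightarrow>
      (\<Sum>j=1..R \<epsilon>. (\<epsilon>\<^sup>2 / (lam j + \<epsilon>\<^sup>2))\<^sup>2 * (\<alpha>0 j)\<^sup>2) \<le> C * real (R \<epsilon>) * \<epsilon>\<^sup>2"
    using A1 by blast
  \<comment> \<open>The bound below has \<open>6 R \<epsilon>\<^sup>2\<close> from variance and noise and \<open>4 C R \<epsilon>\<^sup>2\<close> from the bias.\<close>
  define K where "K = 6 + 4 * \<bar>C\<bar>"
  \<comment> \<open>The coefficients in the decomposition are the coordinates of the truth, because the
    remainder is orthogonal to \<open>\<psi>\<^sub>1, \<dots>, \<psi>\<^sub>n\<close>.\<close>
  have coord: "(L0 - Lbar) \<bullet> \<psi> n = \<alpha>0 n" if n: "1 \<le> n" for n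
  proof -
    have orth: "\<psi> i \<bullet> \<psi> j = (if i = j then 1 else 0)" if "i \<in> {1..n}" "j \<in> {1..n}" for i j
      using orthonormal that by simp
    have "(\<Sum>j=1..n. \<alpha>0 j *\<^sub>R \<psi> j) = orthogonal_projection (span (\<psi> ` {1..n})) (L0 - Lbar)"
      using E[OF n] decomposition[OF n] by (simp add: algebra_simps)
    also have "\<dots> = (\<Sum>j=1..n. ((L0 - Lbar) \<bullet> \<psi> j) *\<^sub>R \<psi> j)"
      by (rule orthogonal_projection_span_orthonormal[OF orth]) auto
    finally show ?thesis
      using inner_orthonormal_sum[of "{1..n}" \<psi> n \<alpha>0, OF orth]
        inner_orthonormal_sum[of "{1..n}" \<psi> n "\<lambda>j. (L0 - Lbar) \<bullet> \<psi> j", OF orth] n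
      by simp
  qed
  have bound: "measure (P \<epsilon>) {y \<in> space (P \<epsilon>). \<bar>X \<epsilon> y - 0\<bar> > \<eta>}
      \<le> measure (P \<epsilon>) {y \<in> space (P \<epsilon>). \<bar>measure (Post \<epsilon> y) (A \<epsilon>) - 1\<bar> > \<eta> / 2}
        + K / ((\<eta> / 2) * (Meps \<epsilon>)\<^sup>2)"
    if \<eta>: "\<eta> > 0" and eps: "\<epsilon> > 0" and MM: "Meps \<epsilon> > 0" for \<eta> \<epsilon>
  proof -
    have b0: "b (R \<epsilon>) \<ge> 0"
      using bias(1)[OF eps] norm_ge_zero order_trans by blast
    have \<delta>0: "\<delta> \<epsilon> > 0"
      unfolding \<delta>_def using eps R[OF eps] b0 by (intro add_pos_nonneg mult_pos_pos) auto
    have \<rho>: "Meps \<epsilon> * \<delta> \<epsilon> > 0"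
      using MM \<delta>0 by simp
    have lam: "lam j > 0" if "j \<in> {1..R \<epsilon>}" for j
      using eigen(2) that by simp
    have orth: "\<psi> i \<bullet> \<psi> j = (if i = j then 1 else 0)" if "i \<in> {1..R \<epsilon>}" "j \<in> {1..R \<epsilon>}" for i j
      using orthonormal that by simp
    interpret P: prob_space "P \<epsilon>"
      unfolding P_def by (rule prob_space_observation_law[OF noise])
    have far: "far \<epsilon> \<in> sets borel"
      unfolding far_def by measurable
    have meas: "(\<lambda>y. measure (Post \<epsilon> y) B) \<in> borel_measurable (P \<epsilon>)" if "B \<in> sets borel" for B
      using posterior_measurable_in_data[where R = "R \<epsilon>", OF eps lam orth that]
      by (simp add: P_def Post_def observation_law_def)
    have events: "{y \<in> space (P \<epsilon>). \<bar>measure (Post \<epsilon> y) (A \<epsilon>) - 1\<bar> > \<eta> / 2} \<in> P.events"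
      "{y \<in> space (P \<epsilon>). measure (Post \<epsilon> y) (far \<epsilon>) > \<eta> / 2} \<in> P.events"
      by (intro borel_measurable_less borel_measurable_const borel_measurable_abs
          borel_measurable_diff meas far A2(1)[OF eps])+
    have X: "X \<epsilon> y \<le> 1 - measure (Post \<epsilon> y) (A \<epsilon>) + measure (Post \<epsilon> y) (far \<epsilon>)" for y
    proof -
      have sets: "sets (Post \<epsilon> y) = sets borel"
        by (simp add: Post_def posterior_def expansion_law_def)
      interpret prob_space "Post \<epsilon> y"
        unfolding Post_def by (rule prob_space_posterior[OF eps lam])
      show ?thesis
        unfolding X_def
      proof (rule pushforward_mass_le)
        show "Rec \<in> measurable (Post \<epsilon> y) (conductivity_space D D0 \<alpha> m)"
          using Rec by (simp add: measurable_cong_sets[OF sets refl])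
        show "A \<epsilon> \<in> events" "far \<epsilon> \<in> events"
          using A2(1)[OF eps] far by (simp_all add: sets)
        fix T assume T: "T \<in> A \<epsilon>" "Rec T \<in> S \<epsilon>"
        show "T \<in> far \<epsilon>"
        proof (rule ccontr)
          assume "T \<notin> far \<epsilon>"
          then have "\<omega> (norm (T - L0)) \<le> \<omega> (Meps \<epsilon> * \<delta> \<epsilon>)"
            using A3(1) \<rho> unfolding modulus_of_continuity_def far_def
            by (auto elim!: mono_onD)
          then show False
            using A3(2)[OF eps T(1)] T(2) by (simp add: S_def)
        qed
      qed
    qed
    have "{y \<in> space (P \<epsilon>). \<bar>X \<epsilon> y - 0\<bar> > \<eta>}
        \<subseteq> {y \<in> space (P \<epsilon>). \<bar>measure (Post \<epsilon> y) (A \<epsilon>) - 1\<bar> > \<eta> / 2}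
          \<union> {y \<in> space (P \<epsilon>). measure (Post \<epsilon> y) (far \<epsilon>) > \<eta> / 2}"
    proof
      fix y assume y: "y \<in> {y \<in> space (P \<epsilon>). \<bar>X \<epsilon> y - 0\<bar> > \<eta>}"
      have "X \<epsilon> y \<ge> 0" by (simp add: X_def)
      then show "y \<in> {y \<in> space (P \<epsilon>). \<bar>measure (Post \<epsilon> y) (A \<epsilon>) - 1\<bar> > \<eta> / 2}
          \<union> {y \<in> space (P \<epsilon>). measure (Post \<epsilon> y) (far \<epsilon>) > \<eta> / 2}"
        using X[of y] y by (auto simp: abs_if split: if_splits)
    qed
    then have "P.prob {y \<in> space (P \<epsilon>). \<bar>X \<epsilon> y - 0\<bar> > \<eta>}
        \<le> P.prob ({y \<in> space (P \<epsilon>). \<bar>measure (Post \<epsilon> y) (A \<epsilon>) - 1\<bar> > \<eta> / 2}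
          \<union> {y \<in> space (P \<epsilon>). measure (Post \<epsilon> y) (far \<epsilon>) > \<eta> / 2})"
      using events by (intro P.finite_measure_mono) auto
    also have "\<dots> \<le> P.prob {y \<in> space (P \<epsilon>). \<bar>measure (Post \<epsilon> y) (A \<epsilon>) - 1\<bar> > \<eta> / 2}
        + P.prob {y \<in> space (P \<epsilon>). measure (Post \<epsilon> y) (far \<epsilon>) > \<eta> / 2}"
      using events by (intro measure_Un_le)
    also have "P.prob {y \<in> space (P \<epsilon>). measure (Post \<epsilon> y) (far \<epsilon>) > \<eta> / 2}
        \<le> K / ((\<eta> / 2) * (Meps \<epsilon>)\<^sup>2)"
    proof -
      let ?bias = "\<Sum>j=1..R \<epsilon>. (\<epsilon>\<^sup>2 / (lam j + \<epsilon>\<^sup>2))\<^sup>2 * (\<alpha>0 j)\<^sup>2"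
      have truth': "L0 = Lbar + (\<Sum>j=1..R \<epsilon>. \<alpha>0 j *\<^sub>R \<psi> j) + E (R \<epsilon>)"
        using decomposition[OF R[OF eps]] by (simp add: algebra_simps)
      have t: "(L0 - Lbar) \<bullet> \<psi> j = \<alpha>0 j" if "j \<in> {1..R \<epsilon>}" for j
        using coord that by simp
      have "P.prob {y \<in> space (P \<epsilon>). measure (Post \<epsilon> y) (far \<epsilon>) > \<eta> / 2}
          \<le> (6 * real (R \<epsilon>) * \<epsilon>\<^sup>2 + 4 * ?bias + 2 * (b (R \<epsilon>))\<^sup>2) / (\<eta> / 2 * (Meps \<epsilon> * \<delta> \<epsilon>)\<^sup>2)"
        unfolding P_def Post_def far_def
        by (rule posterior_contraction_bound[OF noise eps lam orth t truth' bias(1)[OF eps] \<rho>])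
          (use \<eta> in auto)
      also have "\<dots> \<le> K * (\<delta> \<epsilon>)\<^sup>2 / (\<eta> / 2 * (Meps \<epsilon> * \<delta> \<epsilon>)\<^sup>2)"
      proof (rule divide_right_mono)
        have re: "0 \<le> real (R \<epsilon>) * \<epsilon>\<^sup>2" by simp
        have "?bias \<le> C * (real (R \<epsilon>) * \<epsilon>\<^sup>2)"
          using C[OF eps] by (simp add: mult.assoc)
        also have "\<dots> \<le> \<bar>C\<bar> * (real (R \<epsilon>) * \<epsilon>\<^sup>2)"
          using re by (intro mult_right_mono) auto
        finally have bias_le: "?bias \<le> \<bar>C\<bar> * (real (R \<epsilon>) * \<epsilon>\<^sup>2)" .
        have "2 * (b (R \<epsilon>))\<^sup>2 \<le> K * (b (R \<epsilon>))\<^sup>2"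
          by (intro mult_right_mono) (auto simp: K_def)
        moreover have "K * (real (R \<epsilon>) * \<epsilon>\<^sup>2)
            = 6 * real (R \<epsilon>) * \<epsilon>\<^sup>2 + 4 * (\<bar>C\<bar> * (real (R \<epsilon>) * \<epsilon>\<^sup>2))"
          by (simp add: K_def algebra_simps)
        ultimately have "6 * real (R \<epsilon>) * \<epsilon>\<^sup>2 + 4 * ?bias + 2 * (b (R \<epsilon>))\<^sup>2
            \<le> K * (real (R \<epsilon>) * \<epsilon>\<^sup>2) + K * (b (R \<epsilon>))\<^sup>2"
          using bias_le by linarith
        also have "\<dots> = K * ((\<epsilon> * sqrt (real (R \<epsilon>)))\<^sup>2 + (b (R \<epsilon>))\<^sup>2)"
          by (simp add: power_mult_distrib algebra_simps)
        also have "\<dots> \<le> K * (\<delta> \<epsilon>)\<^sup>2"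
          unfolding \<delta>_def using eps b0
          by (intro mult_left_mono) (auto simp: power2_sum K_def)
        finally show "6 * real (R \<epsilon>) * \<epsilon>\<^sup>2 + 4 * ?bias + 2 * (b (R \<epsilon>))\<^sup>2 \<le> K * (\<delta> \<epsilon>)\<^sup>2" .
      qed (use \<eta> in simp)
      also have "\<dots> = K / ((\<eta> / 2) * (Meps \<epsilon>)\<^sup>2)"
        using \<delta>0 by (simp add: power_mult_distrib)
      finally show ?thesis .
    qed
    finally show ?thesis by simp
  qed
  have "tends_in_probability P X 0"
    unfolding tends_in_probability_def
  proof (intro allI impI)
    fix \<eta> :: real assume \<eta>: "\<eta> > 0"
    let ?p = "\<lambda>\<epsilon>. measure (P \<epsilon>) {y \<in> space (P \<epsilon>). \<bar>X \<epsilon> y - 0\<bar> > \<eta>}"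
    let ?q = "\<lambda>\<epsilon>. measure (P \<epsilon>) {y \<in> space (P \<epsilon>). \<bar>measure (Post \<epsilon> y) (A \<epsilon>) - 1\<bar> > \<eta> / 2}"
    let ?r = "\<lambda>\<epsilon>. K / ((\<eta> / 2) * (Meps \<epsilon>)\<^sup>2)"
    have q: "(?q \<longlongrightarrow> 0) (at_right 0)"
      using A2(2)[unfolded tends_in_probability_def, rule_format, OF half_gt_zero[OF \<eta>]]
      unfolding P_def Post_def .
    have "filterlim (\<lambda>\<epsilon>. (\<eta> / 2) * (Meps \<epsilon>)\<^sup>2) at_top (at_right 0)"
      using \<eta> Meps by (intro filterlim_tendsto_pos_mult_at_top[OF tendsto_const] filterlim_pow_at_top) auto
    then have r: "(?r \<longlongrightarrow> 0) (at_right 0)"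
      by (intro tendsto_divide_0[OF tendsto_const] filterlim_at_top_imp_at_infinity)
    have ev: "\<forall>\<^sub>F \<epsilon> in at_right 0. ?p \<epsilon> \<le> ?q \<epsilon> + ?r \<epsilon>"
      using eventually_at_right_less[of "0::real"] filterlim_at_top_dense[THEN iffD1, OF Meps, rule_format, of 0]
      by eventually_elim (rule bound[OF \<eta>])
    show "(?p \<longlongrightarrow> 0) (at_right 0)"
      by (rule tendsto_sandwich[OF _ ev tendsto_const])
        (use tendsto_add[OF q r] in auto)
  qed
  then show "tends_in_probability (observation_law M W L0)
      (\<lambda>\<epsilon> y. measure
        (distr (posterior Lbar \<psi> lam (R \<epsilon>) \<epsilon> y) (conductivity_space D D0 \<alpha> m) Rec)
        {\<sigma> \<in> conductivities D D0 \<alpha> m.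
          L2_norm (lebesgue_on D) (\<lambda>x. \<sigma> x - \<sigma>0 x)
            > \<omega> (Meps \<epsilon> * (\<epsilon> * sqrt (real (R \<epsilon>)) + b (R \<epsilon>)))})
      0"
    by (simp add: P_def X_def[abs_def] Post_def S_def \<delta>_def)
qed

end
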